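(* Let $m\ge n+1\ge3$. Let $F:\mathbb{B}^n\to D^{IV}_m$ be a holomorphic isometry which is a rational map and satisfies $F(0)=0$. Then $\deg(F)\le2$; more precisely, either $F$ is a (homogeneous) linear map or $\deg(F)=2$.
   Context: $\mathbb{B}^n=\{z\in\mathbb{C}^n:|z|^2<1\}$; $D^{IV}_m=\{Z\in\mathbb{C}^m: Z\overline{Z}^t<2,\ 1-Z\overline{Z}^t+\tfrac14|ZZ^t|^2>0\}$. Bergman metric $\omega_\Omega=\sqrt{-1}\partial\bar\partial\log K_\Omega$ with $K_{\mathbb{B}^n}=c(1-|z|^2)^{-(n+1)}$, $K_{D^{IV}_m}=c'(1-Z\overline{Z}^t+\tfrac14|ZZ^t|^2)^{-m}$; a holomorphic $F$ is a holomorphic isometry if $F^*\omega_{D^{IV}_m}=\lambda\omega_{\mathbb{B}^n}$ for a constant $\lambda>0$. For a rational map $F=(P_1,\dots,P_m)/R$ written in lowest terms with $P_j,R$ polynomials, $\deg(F)=\max\{\deg P_1,\dots,\deg P_m,\deg R\}$. *)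

theory Defs
  imports "HOL-Analysis.Analysis" "HOL-Library.Poly_Mapping"
begin

text \<open>Points of C^n are vectors complex^'n (n = CARD('n)).
 Polynomials in the n complex coordinates: monomials are exponent maps 'n =>0 nat,
 polynomials are finitely supported coefficient maps (a commutative ring under
 the convolution product of Poly_Mapping).\<close>

definition unit_ball :: "(complex^'n::finite) set" where
  "unit_ball = {z. (\<Sum>j\<in>UNIV. (cmod (z $ j))^2) < 1}"

type_synonym 'n mpoly = "('n \<Rightarrow>\<^sub>0 nat) \<Rightarrow>\<^sub>0 complex"

definition mpeval :: "'n::finite mpoly \<Rightarrow> complex^'n \<Rightarrow> complex" where
  "mpeval p z = (\<Sum>a\<in>Poly_Mapping.keys p. Poly_Mapping.lookup p a * (\<Prod>j\<in>(UNIV::'n set). (z $ j) ^ Poly_Mapping.lookup (a::'n \<Rightarrow>\<^sub>0 nat) j))"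

definition mdeg :: "'n::finite mpoly \<Rightarrow> nat" where
  "mdeg p = Max (insert 0 ((\<lambda>a::'n \<Rightarrow>\<^sub>0 nat. \<Sum>j\<in>(UNIV::'n set). Poly_Mapping.lookup a j) ` Poly_Mapping.keys p))"

definition lowest_terms_rep ::
  "('n::finite mpoly) ^'m \<Rightarrow> 'n mpoly \<Rightarrow> bool" where
  "lowest_terms_rep P R \<longleftrightarrow> R \<noteq> 0 \<and>
     (\<forall>D. (\<forall>k. D dvd P $ k) \<and> D dvd R \<longrightarrow> D dvd 1)"

definition rational_rep ::
  "(complex^'n::finite \<Rightarrow> complex^'m::finite) \<Rightarrow> ('n mpoly)^'m \<Rightarrow> 'n mpoly \<Rightarrow> bool" where
  "rational_rep F P R \<longleftrightarrow> lowest_terms_rep P R \<and>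
     (\<forall>z\<in>unit_ball. mpeval R z \<noteq> 0 \<longrightarrow>
          F z = (\<chi> k. mpeval (P $ k) z / mpeval R z))"

definition rdeg :: "('n::finite mpoly)^'m::finite \<Rightarrow> 'n mpoly \<Rightarrow> nat" where
  "rdeg P R = max (Max (range (\<lambda>k. mdeg (P $ k)))) (mdeg R)"

definition typeIV_domain :: "(complex^'m::finite) set" where
  "typeIV_domain = {Z. (\<Sum>j\<in>UNIV. (cmod (Z $ j))^2) < 2 \<and>
     1 - (\<Sum>j\<in>UNIV. (cmod (Z $ j))^2) + (cmod (\<Sum>j\<in>UNIV. (Z $ j)^2))^2 / 4 > 0}"

text \<open>Bergman kernels on the diagonal (normalising constants c, c' > 0 as parameters)\<close>
definition K_ball :: "real \<Rightarrow> complex^'n::finite \<Rightarrow> real" where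
  "K_ball c z = c * (1 - (\<Sum>j\<in>UNIV. (cmod (z $ j))^2)) powr (- real (CARD('n) + 1))"

definition K_IV :: "real \<Rightarrow> complex^'m::finite \<Rightarrow> real" where
  "K_IV c Z = c * (1 - (\<Sum>j\<in>UNIV. (cmod (Z $ j))^2) + (cmod (\<Sum>j\<in>UNIV. (Z $ j)^2))^2 / 4)
                 powr (- real CARD('m))"

definition holo_on :: "(complex^'n::finite \<Rightarrow> complex^'m::finite) \<Rightarrow> (complex^'n) set \<Rightarrow> bool" where
  "holo_on F S \<longleftrightarrow> (\<forall>z\<in>S. \<exists>L. (F has_derivative L) (at z) \<and>
        (\<forall>c v. L (c *s v) = c *s L v))"

text \<open>Wirtinger derivatives and the coefficient matrix of i ddbar phi
  (i ddbar phi = i sum_{j,k} levi phi z j k dz_j wedge dzbar_k).\<close>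
definition pdir :: "(complex^'n::finite \<Rightarrow> complex) \<Rightarrow> complex^'n \<Rightarrow> complex^'n \<Rightarrow> complex" where
  "pdir g v z = vector_derivative (\<lambda>t::real. g (z + t *\<^sub>R v)) (at 0)"

definition wd :: "'n::finite \<Rightarrow> (complex^'n \<Rightarrow> complex) \<Rightarrow> complex^'n \<Rightarrow> complex" where
  "wd j g z = (pdir g (axis j 1) z - \<i> * pdir g (axis j \<i>) z) / 2"

definition wdbar :: "'n::finite \<Rightarrow> (complex^'n \<Rightarrow> complex) \<Rightarrow> complex^'n \<Rightarrow> complex" where
  "wdbar j g z = (pdir g (axis j 1) z + \<i> * pdir g (axis j \<i>) z) / 2"

definition levi :: "(complex^'n::finite \<Rightarrow> real) \<Rightarrow> complex^'n \<Rightarrow> 'n \<Rightarrow> 'n \<Rightarrow> complex" where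
  "levi \<phi> z j k = wd j (\<lambda>w. wdbar k (\<lambda>u. complex_of_real (\<phi> u)) w) z"

text \<open>Holomorphic isometry F^* omega_D = lambda omega_B. For holomorphic F,
  F^*(i ddbar log K_D) = i ddbar (log K_D o F).\<close>
definition holo_isometry ::
  "real \<Rightarrow> real \<Rightarrow> (complex^'n::finite \<Rightarrow> complex^'m::finite) \<Rightarrow> real \<Rightarrow> bool" where
  "holo_isometry c c' F lam \<longleftrightarrow> holo_on F unit_ball \<and> F ` unit_ball \<subseteq> typeIV_domain \<and>
     (\<forall>z\<in>unit_ball. \<forall>j k. levi (\<lambda>w. ln (K_IV c' (F w))) z j k
                         = lam * levi (\<lambda>w. ln (K_ball c w)) z j k)"

end

theory Submission
  imports Defs "HOL-Complex_Analysis.Complex_Analysis" "HOL-Real_Asymp.Real_Asymp"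
begin

text \<open>
  Write \<open>F\<cdot>F\<close> for the sum of the squares of the components. Since \<open>log N - \<mu> log M\<close> with
  \<open>N = 1 - |F|\<^sup>2 + |F\<cdot>F|\<^sup>2/4\<close>, \<open>M = 1 - |z|\<^sup>2\<close> and \<open>\<mu> = \<lambda>(n+1)/m\<close> is pluriharmonic without pure
  terms at 0, it vanishes, so \<open>N = M\<^sup>\<mu>\<close>. As \<open>F\<close> is rational, \<open>\<mu>\<close> is a positive integer; and \<open>\<mu> \<ge> 2\<close> is
  impossible, because for \<open>n \<ge> 2\<close> there is a line direction \<open>v \<noteq> 0\<close> which is isotropic for the quadratic
  part of \<open>F\<cdot>F\<close>, and the second Taylor coefficient of \<open>F\<close> along it would have squared norm
  \<open>-\<mu>(\<mu>-1)/2 < 0\<close>.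

  For \<open>\<mu> = 1\<close> we get \<open>|F|\<^sup>2 = |z|\<^sup>2 + |g|\<^sup>2\<close> with \<open>g = F\<cdot>F/2\<close>; polarization gives \<open>F = Az + g b\<close> with \<open>b\<close> a unit
  vector orthogonal to the range of \<open>A\<close>, or \<open>g = 0\<close>. Thus \<open>\<beta> g\<^sup>2 - 2(1-l) g + q = 0\<close> where \<open>\<beta> = b\<cdot>b\<close>,
  \<open>l = Az\<cdot>b\<close>, \<open>q = Az\<cdot>Az\<close>. If \<open>\<beta> \<noteq> 0\<close>, rationality of \<open>g\<close> makes the discriminant a square on every line
  through 0, which forces \<open>q = 0\<close> and \<open>g = 0\<close>. If \<open>\<beta> = 0\<close>, then \<open>F = Az + q b / (2(1-l))\<close>, which has
  degree 2 unless \<open>q = 0\<close>.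
\<close>

unbundle no Formal_Power_Series.fps_syntax

section \<open>Polynomials in several variables\<close>

lemma poly_mapping_sum_monomials:
  fixes p :: "'a \<Rightarrow>\<^sub>0 'b::comm_monoid_add"
  shows "(\<Sum>a\<in>Poly_Mapping.keys p. Poly_Mapping.single a (Poly_Mapping.lookup p a)) = p"
  by (rule poly_mapping_eqI)
     (auto simp: lookup_sum lookup_single when_def in_keys_iff)

lemma norm_vector_scalar_mult: "norm (c *s v) = cmod c * norm (v :: complex^'n::finite)"
  by (simp add: norm_vec_def L2_set_right_distrib norm_mult)

section \<open>Evaluation as a ring homomorphism\<close>

definition mconst :: "complex \<Rightarrow> 'n::finite mpoly" where
  "mconst c = Poly_Mapping.single 0 c"

definition mvar :: "'n::finite \<Rightarrow> 'n mpoly" where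
  "mvar j = Poly_Mapping.single (Poly_Mapping.single j 1) 1"

definition mono_eval :: "('n::finite \<Rightarrow>\<^sub>0 nat) \<Rightarrow> complex^'n \<Rightarrow> complex" where
  "mono_eval a z = (\<Prod>j\<in>UNIV. (z $ j) ^ Poly_Mapping.lookup a j)"

lemma mono_eval_0 [simp]: "mono_eval 0 z = 1"
  by (simp add: mono_eval_def)

lemma mono_eval_add: "mono_eval (a + b) z = mono_eval a z * mono_eval b z"
  by (simp add: mono_eval_def lookup_add power_add prod.distrib)

lemma mpeval_superset:
  assumes "finite S" "Poly_Mapping.keys p \<subseteq> S"
  shows "mpeval p z = (\<Sum>a\<in>S. Poly_Mapping.lookup p a * mono_eval a z)"
  unfolding mpeval_def mono_eval_def[symmetric]
  using assms by (intro sum.mono_neutral_left) (auto simp: in_keys_iff)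

lemma mpeval_single [simp]: "mpeval (Poly_Mapping.single a c) z = c * mono_eval a z"
  by (subst mpeval_superset[where S="{a}"]) auto

lemma mpeval_0 [simp]: "mpeval 0 z = 0"
  by (simp add: mpeval_def)

lemma mpeval_add [simp]: "mpeval (p + q) z = mpeval p z + mpeval q z"
proof -
  let ?S = "Poly_Mapping.keys p \<union> Poly_Mapping.keys q"
  have "Poly_Mapping.keys (p + q) \<subseteq> ?S" by (rule Poly_Mapping.keys_add)
  then show ?thesis
    by (subst (1 2 3) mpeval_superset[where S="?S"])
       (auto simp: lookup_add algebra_simps sum.distrib)
qed

lemma mpeval_uminus [simp]: "mpeval (- p) z = - mpeval p z"
  using mpeval_add[of p "- p" z] by (simp add: eq_neg_iff_add_eq_0 add.commute)

lemma mpeval_diff [simp]: "mpeval (p - q) z = mpeval p z - mpeval q z"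
  using mpeval_add[of "p" "- q" z] by simp

lemma mpoly_single_induct [case_names single add]:
  fixes p :: "'n::finite mpoly"
  assumes single: "\<And>a c. Q (Poly_Mapping.single a c)"
    and add: "\<And>p q. Q p \<Longrightarrow> Q q \<Longrightarrow> Q (p + q)"
  shows "Q p"
proof -
  have "Q 0" using single[of 0 0] by simp
  have "Q (\<Sum>a\<in>S. Poly_Mapping.single a (Poly_Mapping.lookup p a))" if "finite S" for S
    using that by induction (auto simp: \<open>Q 0\<close> intro: single add)
  then have "Q (\<Sum>a\<in>Poly_Mapping.keys p. Poly_Mapping.single a (Poly_Mapping.lookup p a))"
    by simp
  then show ?thesis by (simp add: poly_mapping_sum_monomials)
qed

lemma mpeval_mult [simp]: "mpeval (p * q) z = mpeval p z * mpeval q z"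
proof (induction p rule: mpoly_single_induct)
  case (single a c)
  show ?case
    by (induction q rule: mpoly_single_induct)
       (auto simp: mult_single mono_eval_add algebra_simps)
qed (auto simp: algebra_simps)

lemma mpeval_const [simp]: "mpeval (mconst c) z = c"
  by (simp add: mconst_def)

lemma mpeval_1 [simp]: "mpeval 1 z = 1"
  using mpeval_const[of 1 z] by (simp add: mconst_def)

lemma mpeval_var [simp]: "mpeval (mvar j) z = z $ j"
proof -
  have "mono_eval (Poly_Mapping.single j 1) z = (\<Prod>i\<in>UNIV. if i = j then z $ i else 1)"
    unfolding mono_eval_def by (intro prod.cong) (auto simp: lookup_single when_def)
  then show ?thesis by (simp add: mvar_def)
qed

lemma mpeval_sum [simp]: "mpeval (\<Sum>i\<in>S. p i) z = (\<Sum>i\<in>S. mpeval (p i) z)"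
  by (induction S rule: infinite_finite_induct) auto

text \<open>Induction over ring generators: a property stable under sums and products, such as being
  a polynomial along a line or having polynomial partial derivatives, is checked on constants and
  coordinates only. Monomials arise as products of coordinate powers.\<close>

lemma mpoly_induct [case_names const var add mult]:
  fixes p :: "'n::finite mpoly"
  assumes const: "\<And>c. Q (mconst c)" and var: "\<And>j. Q (mvar j)"
    and add: "\<And>p q. Q p \<Longrightarrow> Q q \<Longrightarrow> Q (p + q)"
    and mult: "\<And>p q. Q p \<Longrightarrow> Q q \<Longrightarrow> Q (p * q)"
  shows "Q p"
proof (induction p rule: mpoly_single_induct)
  case (single a c)
  have one: "Q 1" using const[of 1] by (simp add: mconst_def)
  have vp: "Q (Poly_Mapping.single (Poly_Mapping.single j k) 1)" for j k
  proof (induction k)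
    case (Suc k)
    have "Poly_Mapping.single (Poly_Mapping.single j (Suc k)) (1::complex)
      = mvar j * Poly_Mapping.single (Poly_Mapping.single j k) 1"
      by (simp add: mvar_def mult_single flip: single_add)
    then show ?case using mult[OF var Suc] by simp
  qed (use one in simp)
  have "Q (Poly_Mapping.single (\<Sum>j\<in>S. Poly_Mapping.single j (Poly_Mapping.lookup a j)) 1)"
    if "finite S" for S
    using that
  proof induction
    case (insert x F)
    then show ?case using mult[OF vp[of x "Poly_Mapping.lookup a x"] insert.IH]
      by (simp add: mult_single)
  qed (use one in simp)
  from this[of "Poly_Mapping.keys a"]
  have "Q (Poly_Mapping.single a 1)" by (simp add: poly_mapping_sum_monomials)
  from mult[OF const[of c] this] show ?case by (simp add: mconst_def mult_single)
qed (rule add)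

text \<open>Restriction to a complex line turns questions in several variables into questions about
  roots and degrees of one-variable polynomials.\<close>

lemma mpeval_line:
  "\<exists>q. \<forall>t. mpeval p (u + t *s v) = poly q t"
proof (induction p rule: mpoly_induct)
  case (const c) then show ?case by (intro exI[of _ "[:c:]"]) auto
next
  case (var j) then show ?case by (intro exI[of _ "[:u $ j, v $ j:]"]) (auto simp: algebra_simps)
next
  case (add p q) then show ?case by (metis mpeval_add poly_add)
next
  case (mult p q) then show ?case by (metis mpeval_mult poly_mult)
qed

text \<open>Kronecker substitution \<open>z\<^sub>j = t ^ (k ^ e j)\<close>: for suitable \<open>k\<close> distinct monomials become distinct
  powers of \<open>t\<close>.\<close>
lemma mpoly_nonzero_somewhere:
  assumes "p \<noteq> 0" shows "\<exists>z. mpeval p z \<noteq> 0"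
proof -
  define K where "K = Poly_Mapping.keys p"
  obtain e :: "'a \<Rightarrow> nat" where e: "inj e"
    using finite_imp_inj_to_nat_seg[of "UNIV :: 'a set"] by auto
  \<comment> \<open>\<open>h a\<close> is the exponent of t as a polynomial in the still unchosen k.
    Distinct monomials give distinct \<open>h\<close>, so two exponents collide only when k is a
    root of one of finitely many nonzero differences.\<close>
  define h :: "('a \<Rightarrow>\<^sub>0 nat) \<Rightarrow> int poly"
    where "h a = (\<Sum>j\<in>UNIV. monom (int (Poly_Mapping.lookup a j)) (e j))" for a
  have coeff_h: "coeff (h a) (e i) = int (Poly_Mapping.lookup a i)" for a i
    using e by (simp add: h_def coeff_sum inj_eq)
  have h_inj: "h a \<noteq> h b" if "a \<noteq> b" for a b
  proof
    assume "h a = h b"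
    then have "Poly_Mapping.lookup a i = Poly_Mapping.lookup b i" for i
      using coeff_h[of a i] coeff_h[of b i] by simp
    then show False using that by (auto intro: poly_mapping_eqI)
  qed
  have fin: "finite (\<Union>(a,b)\<in>{(a,b)\<in>K\<times>K. a \<noteq> b}. {x. poly (h a - h b) x = 0})"
  proof (rule finite_UN_I)
    show "finite {(a,b)\<in>K\<times>K. a \<noteq> b}"
      by (rule finite_subset[of _ "K \<times> K"]) (auto simp: K_def)
    show "finite (case x of (a, b) \<Rightarrow> {x. poly (h a - h b) x = 0})"
      if "x \<in> {(a,b)\<in>K\<times>K. a \<noteq> b}" for x
      using that poly_roots_finite[of "h (fst x) - h (snd x)"] h_inj[of "fst x" "snd x"]
      by (cases x) auto
  qed
  then have "finite (int -` (\<Union>(a,b)\<in>{(a,b)\<in>K\<times>K. a \<noteq> b}. {x. poly (h a - h b) x = 0}))"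
    by (intro finite_vimageI) auto
  then obtain k :: nat where
    "k \<notin> int -` (\<Union>(a,b)\<in>{(a,b)\<in>K\<times>K. a \<noteq> b}. {x. poly (h a - h b) x = 0})"
    using ex_new_if_finite infinite_UNIV_nat by blast
  then have k: "poly (h a) (int k) \<noteq> poly (h b) (int k)" if "a \<in> K" "b \<in> K" "a \<noteq> b" for a b
    using that by auto
  define w where "w a = (\<Sum>j\<in>UNIV. k ^ e j * Poly_Mapping.lookup a j)" for a :: "'a \<Rightarrow>\<^sub>0 nat"
  have "int (w a) = poly (h a) (int k)" for a
    by (simp add: w_def h_def poly_sum poly_monom algebra_simps)
  then have w_inj: "inj_on w K" using k by (metis inj_onI)
  define q where "q = (\<Sum>a\<in>K. monom (Poly_Mapping.lookup p a) (w a))"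
  have ev: "mpeval p (\<chi> j. t ^ (k ^ e j)) = poly q t" for t
    by (simp add: q_def poly_sum poly_monom mpeval_def K_def w_def power_sum power_mult)
  obtain a where a: "a \<in> K" using assms unfolding K_def by (metis all_not_in_conv keys_eq_empty)
  have "coeff q (w a) = (\<Sum>b\<in>K. if b = a then Poly_Mapping.lookup p b else 0)"
    unfolding q_def coeff_sum using w_inj a by (intro sum.cong) (auto dest: inj_onD)
  also have "\<dots> = Poly_Mapping.lookup p a" using a by (simp add: K_def)
  also have "\<dots> \<noteq> 0" using a by (simp add: K_def in_keys_iff)
  finally have "q \<noteq> 0" by auto
  then show ?thesis using ev poly_all_0_iff_0 by metis
qed

text \<open>On a complex line through the centre and a nonzero of \<open>p\<close>, \<open>p\<close> is a nonzero polynomial.\<close>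
lemma mpoly_nonzero_in_ball:
  fixes p :: "'n::finite mpoly"
  assumes "p \<noteq> 0" "r > 0"
  shows "\<exists>z\<in>ball z0 r. mpeval p z \<noteq> 0"
proof (rule ccontr)
  assume c: "\<not> ?thesis"
  obtain z1 where z1: "mpeval p z1 \<noteq> 0" using mpoly_nonzero_somewhere[OF assms(1)] by auto
  obtain q where q: "\<And>t. mpeval p (z0 + t *s (z1 - z0)) = poly q t"
    using mpeval_line by blast
  \<comment> \<open>The summand 1 keeps the denominator positive even when
    \<open>z1 = z0\<close>.\<close>
  define s where "s = r / (norm (z1 - z0) + 1)"
  have "s > 0" unfolding s_def using assms(2) by (auto intro!: divide_pos_pos add_nonneg_pos)
  have "poly q t = 0" if "t \<in> ball 0 s" for t
  proof -
    have "norm (t *s (z1 - z0)) = cmod t * norm (z1 - z0)"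
      by (rule norm_vector_scalar_mult)
    also have "\<dots> \<le> cmod t * (norm (z1 - z0) + 1)" by (intro mult_left_mono) auto
    also have "\<dots> < r" using that
      by (simp add: s_def pos_less_divide_eq add_nonneg_pos)
    finally have "dist (z0 + t *s (z1 - z0)) z0 < r" by (simp add: dist_norm)
    then have "z0 + t *s (z1 - z0) \<in> ball z0 r" by (simp add: dist_commute)
    then show ?thesis using c q by metis
  qed
  then have "ball 0 s \<subseteq> {t. poly q t = 0}" by auto
  moreover have "infinite (ball (0::complex) s)"
    using uncountable_infinite[OF uncountable_ball[OF \<open>s > 0\<close>]] .
  ultimately have "q = 0" using poly_roots_finite finite_subset by blast
  then have "mpeval p (z0 + 1 *s (z1 - z0)) = 0" using q by (metis poly_0)
  then show False using z1 by simp
qed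

lemma mpoly_eqI_ball:
  fixes p :: "'n::finite mpoly"
  assumes "r > 0" "\<And>z. z \<in> ball z0 r \<Longrightarrow> mpeval p z = mpeval q z"
  shows "p = q"
  using mpoly_nonzero_in_ball[of "p - q" r z0] assms by force

lemma mpoly_eqI: "(\<And>z. mpeval p z = mpeval q z) \<Longrightarrow> p = q"
  by (rule mpoly_eqI_ball[of 1]) auto

text \<open>By continuity \<open>p\<close> stays nonzero on a small ball around a point where it is
  nonzero, and \<open>q\<close> has a nonzero value inside that ball.\<close>

lemma mpoly_mult_eq_0:
  fixes p q :: "'n::finite mpoly"
  assumes "p * q = 0" shows "p = 0 \<or> q = 0"
proof (rule ccontr)
  assume c: "\<not> ?thesis"
  obtain z where z: "mpeval p z \<noteq> 0" using mpoly_nonzero_in_ball[of p 1] c by auto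
  have "isCont (mpeval p) z"
    unfolding mpeval_def by (intro continuous_intros)
  then have "eventually (\<lambda>w. mpeval p w \<noteq> 0) (at z)"
    using z tendsto_imp_eventually_ne[of "mpeval p" "mpeval p z" "at z" 0] by (simp add: isCont_def)
  then obtain r where r: "r > 0" "\<And>w. w \<in> ball z r \<Longrightarrow> mpeval p w \<noteq> 0"
    using z unfolding eventually_at by (metis UNIV_I dist_commute mem_ball)
  obtain w where "w \<in> ball z r" "mpeval q w \<noteq> 0" using mpoly_nonzero_in_ball[of q r z] c r by auto
  then show False using r(2) assms by (metis mpeval_0 mpeval_mult mult_eq_0_iff)
qed

text \<open>Along every line through 0 a unit restricts to a one-variable divisor of 1, hence to a
  constant. Common factors in a lowest-terms representation are recognized as scalars in this
  way.\<close>

lemma mpoly_unit_const: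
  fixes p :: "'n::finite mpoly"
  assumes "p dvd 1" shows "\<exists>c. c \<noteq> 0 \<and> p = mconst c"
proof -
  obtain s where s: "p * s = 1" using assms by (metis dvdE)
  have "mpeval p z = mpeval p 0" for z
  proof -
    obtain f g where fg: "\<And>t. mpeval p (0 + t *s z) = poly f t" "\<And>t. mpeval s (0 + t *s z) = poly g t"
      using mpeval_line by meson
    have "poly (f * g) t = poly 1 t" for t
      using fg s by (metis mpeval_1 mpeval_mult poly_1 poly_mult)
    then have "f * g = 1" by (meson poly_eq_poly_eq_iff ext)
    then have "degree f = 0"
      by (metis add_is_0 degree_1 degree_mult_eq mult_zero_left mult_zero_right one_neq_zero)
    then have "poly f 1 = poly f 0" by (metis degree_eq_zeroE poly_pCons poly_0 mult_zero_right)
    then show ?thesis using fg(1)[of 1] fg(1)[of 0] by simp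
  qed
  then have "p = mconst (mpeval p 0)" by (intro mpoly_eqI) simp
  moreover have "mpeval p 0 \<noteq> 0" using s by (metis mpeval_1 mpeval_mult mult_zero_left zero_neq_one)
  ultimately show ?thesis by blast
qed

section \<open>Total degree and derivatives of polynomials\<close>

definition total_deg :: "('n::finite \<Rightarrow>\<^sub>0 nat) \<Rightarrow> nat" where
  "total_deg a = (\<Sum>j\<in>UNIV. Poly_Mapping.lookup a j)"

lemma mdeg_le_iff: "mdeg p \<le> d \<longleftrightarrow> (\<forall>a\<in>Poly_Mapping.keys p. total_deg a \<le> d)"
  unfolding mdeg_def total_deg_def by (subst Max_le_iff) auto

lemma mdeg_add: "mdeg p \<le> d \<Longrightarrow> mdeg q \<le> d \<Longrightarrow> mdeg (p + q) \<le> d"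
  unfolding mdeg_le_iff using Poly_Mapping.keys_add[of p q] by auto

lemma mdeg_uminus [simp]: "mdeg (- p) = mdeg p"
  by (simp add: mdeg_def)

lemma mdeg_diff: "mdeg p \<le> d \<Longrightarrow> mdeg q \<le> d \<Longrightarrow> mdeg (p - q) \<le> d"
  using mdeg_add[of p d "- q"] by simp

lemma mdeg_sum: "(\<And>i. i \<in> S \<Longrightarrow> mdeg (p i) \<le> d) \<Longrightarrow> mdeg (\<Sum>i\<in>S. p i) \<le> d"
  by (induction S rule: infinite_finite_induct) (auto intro: mdeg_add simp: mdeg_def[of 0])

lemma mdeg_mult: "mdeg p \<le> d \<Longrightarrow> mdeg q \<le> e \<Longrightarrow> mdeg (p * q) \<le> d + e"
  unfolding mdeg_le_iff
proof
  fix a assume *: "\<forall>a\<in>Poly_Mapping.keys p. total_deg a \<le> d" "\<forall>a\<in>Poly_Mapping.keys q. total_deg a \<le> e"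
    "a \<in> Poly_Mapping.keys (p * q)"
  then obtain b c where "b \<in> Poly_Mapping.keys p" "c \<in> Poly_Mapping.keys q" "a = b + c"
    using keys_mult[of p q] by blast
  then show "total_deg a \<le> d + e" using *(1,2)
    by (auto simp: total_deg_def lookup_add sum.distrib intro: add_mono)
qed

lemma mdeg_const [simp]: "mdeg (mconst c) = 0"
  using mdeg_le_iff[of "mconst c" 0] by (auto simp: mconst_def total_deg_def split: if_splits)

lemma mdeg_1 [simp]: "mdeg 1 = 0"
  using mdeg_const[of 1] by (simp add: mconst_def)

lemma mdeg_var: "mdeg (mvar j :: 'n::finite mpoly) \<le> 1"
  by (auto simp: mdeg_le_iff mvar_def total_deg_def lookup_single when_def)

text \<open>Along \<open>t *s z\<close> a monomial becomes a multiple of t raised to its total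
  degree, so a degree bound for a polynomial becomes the vanishing of coefficients in t.\<close>

lemma mpeval_ray_degree:
  "\<exists>q. degree q \<le> mdeg p \<and> (\<forall>t. mpeval p (t *s z) = poly q t)"
proof (intro exI conjI allI)
  let ?q = "\<Sum>a\<in>Poly_Mapping.keys p. monom (Poly_Mapping.lookup p a * mono_eval a z) (total_deg a)"
  show "degree ?q \<le> mdeg p"
    by (intro degree_sum_le) (auto intro: order_trans[OF degree_monom_le] mdeg_le_iff[THEN iffD1, rule_format])
  show "mpeval p (t *s z) = poly ?q t" for t
    by (simp add: mpeval_def poly_sum poly_monom mono_eval_def power_mult_distrib prod.distrib
        total_deg_def power_sum algebra_simps)
qed

text \<open>The partial derivatives are again polynomials, fixed before z is chosen; this permits a
  second differentiation of the rational map.\<close>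

lemma mpeval_has_derivative:
  "\<exists>p'. \<forall>z. (mpeval p has_derivative (\<lambda>v. \<Sum>j\<in>UNIV. mpeval (p' j) z * v $ j)) (at z)"
proof (induction p rule: mpoly_induct)
  case (const c) 
  have "mpeval (mconst c) = (\<lambda>z. c)" by auto
  then show ?case by (intro exI[of _ "\<lambda>j. 0"]) auto
next
  case (var j)
  have "mpeval (mvar j) = (\<lambda>z. z $ j)" by auto
  moreover have "(\<Sum>i\<in>UNIV. mpeval (mconst (of_bool (i = j))) z * v $ i) = v $ j" for z v
    by (simp add: of_bool_def if_distrib[of "\<lambda>x. x * _"] cong: if_cong)
  ultimately show ?case
    by (intro exI[of _ "\<lambda>i. mconst (of_bool (i = j))"])
       (auto intro!: bounded_linear_imp_has_derivative bounded_linear_vec_nth)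
next
  case (add p q)
  then obtain p' q' where d: "\<And>z. (mpeval p has_derivative (\<lambda>v. \<Sum>j\<in>UNIV. mpeval (p' j) z * v $ j)) (at z)"
    "\<And>z. (mpeval q has_derivative (\<lambda>v. \<Sum>j\<in>UNIV. mpeval (q' j) z * v $ j)) (at z)" by blast
  have e: "mpeval (p + q) = (\<lambda>z. mpeval p z + mpeval q z)" by auto
  show ?case unfolding e
    by (intro exI[of _ "\<lambda>i. p' i + q' i"] allI)
       (rule has_derivative_eq_rhs[OF has_derivative_add[OF d]], auto simp: algebra_simps sum.distrib)
next
  case (mult p q)
  then obtain p' q' where d: "\<And>z. (mpeval p has_derivative (\<lambda>v. \<Sum>j\<in>UNIV. mpeval (p' j) z * v $ j)) (at z)"
    "\<And>z. (mpeval q has_derivative (\<lambda>v. \<Sum>j\<in>UNIV. mpeval (q' j) z * v $ j)) (at z)" by blast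
  have e: "mpeval (p * q) = (\<lambda>z. mpeval p z * mpeval q z)" by auto
  show ?case unfolding e
    by (intro exI[of _ "\<lambda>i. p' i * q + p * q' i"] allI)
       (rule has_derivative_eq_rhs[OF has_derivative_mult[OF d]],
        auto simp: algebra_simps sum.distrib sum_distrib_left)
qed

section \<open>Divisibility by 1 - l for a linear form l\<close>

definition linear_form :: "('n::finite \<Rightarrow> complex) \<Rightarrow> 'n mpoly" where
  "linear_form a = (\<Sum>j\<in>UNIV. mconst (a j) * mvar j)"

lemma mpeval_linear_form [simp]: "mpeval (linear_form a) z = (\<Sum>j\<in>UNIV. a j * z $ j)"
  by (simp add: linear_form_def)

lemma mdeg_linear_form: "mdeg (linear_form a) \<le> 1"
  unfolding linear_form_def
  by (intro mdeg_sum) (use mdeg_mult[of "mconst _" 0 "mvar _" 1] mdeg_var in force)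

text \<open>Solving \<open>l = 1\<close> for the coordinate \<open>z\<^sub>j\<close> gives a remainder that does not see \<open>z\<^sub>j\<close>.\<close>
lemma dvd_if_vanishes_on_hyperplane:
  fixes f :: "'n::finite mpoly"
  assumes j: "a j \<noteq> 0"
    and van: "\<And>z. (\<Sum>i\<in>UNIV. a i * z $ i) = 1 \<Longrightarrow> mpeval f z = 0"
  shows "(1 - linear_form a) dvd f"
proof -
  let ?D = "1 - linear_form a"
  \<comment> \<open>\<open>y\<close> is the value of coordinate j that solves l = 1 while the other
    coordinates are kept, so \<open>s\<close> projects onto the hyperplane l = 1 along the j-th
    axis.\<close>
  define y where "y = mvar j + mconst (1 / a j) * ?D"
  define s where "s z = (\<chi> i. if i = j then mpeval y z else z $ i)" for z
  \<comment> \<open>\<open>g\<close> is \<open>f\<close> with \<open>y\<close> substituted for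
    coordinate j. As \<open>y\<close> differs from that coordinate by a multiple of 1 - l, the same
    holds for \<open>g\<close> and \<open>f\<close>.\<close>
  have "\<exists>g. ?D dvd f - g \<and> (\<forall>z. mpeval g z = mpeval f (s z))"
  proof (induction f rule: mpoly_induct)
    case (const c) then show ?case by (intro exI[of _ "mconst c"]) auto
  next
    case (var i)
    show ?case
      by (intro exI[of _ "if i = j then y else mvar i"]) (auto simp: s_def y_def)
  next
    case (add p q)
    then obtain g h where g: "?D dvd p - g" "\<And>z. mpeval g z = mpeval p (s z)"
      and h: "?D dvd q - h" "\<And>z. mpeval h z = mpeval q (s z)" by blast
    have "?D dvd (p - g) + (q - h)" using g h by (intro dvd_add)
    then show ?case using g h by (intro exI[of _ "g + h"]) (auto simp: algebra_simps)
  next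
    case (mult p q)
    then obtain g h where g: "?D dvd p - g" "\<And>z. mpeval g z = mpeval p (s z)"
      and h: "?D dvd q - h" "\<And>z. mpeval h z = mpeval q (s z)" by blast
    have "?D dvd (p - g) * q + g * (q - h)" using g h by (intro dvd_add) auto
    then show ?case using g h by (intro exI[of _ "g * h"]) (auto simp: algebra_simps)
  qed
  then obtain g where g: "?D dvd f - g" "\<And>z. mpeval g z = mpeval f (s z)" by blast
  have "(\<Sum>i\<in>UNIV. a i * s z $ i) = 1" for z
  proof -
    have "(\<Sum>i\<in>UNIV. a i * s z $ i) = (\<Sum>i\<in>UNIV. a i * z $ i + (if i = j then 1 - (\<Sum>i\<in>UNIV. a i * z $ i) else 0))"
      using j by (intro sum.cong) (auto simp: s_def y_def field_simps)
    then show ?thesis by (simp add: sum.distrib)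
  qed
  then have "g = 0" using g(2) van by (intro mpoly_eqI) simp
  then show ?thesis using g by simp
qed

text \<open>An instance of Euclid's lemma: 1 - l behaves like a prime, and a nonzero homogeneous
  \<open>q\<close> cannot vanish identically on the hyperplane l = 1, since a point where l and
  \<open>q\<close> are both nonzero can be rescaled onto it.\<close>

lemma dvd_of_dvd_mult_homogeneous:
  fixes f q :: "'n::finite mpoly"
  assumes hom: "\<And>t z. mpeval q (t *s z) = t ^ d * mpeval q z" and q: "q \<noteq> 0"
    and dvd: "(1 - linear_form a) dvd f * q"
  shows "(1 - linear_form a) dvd f"
proof (cases "linear_form a = 0")
  case False
  let ?l = "\<lambda>z. \<Sum>i\<in>UNIV. a i * z $ i"
  obtain j where j: "a j \<noteq> 0"
  proof (rule ccontr)
    assume "\<not> thesis" then have "\<And>j. a j = 0" using that by blast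
    then have "linear_form a = 0" by (intro mpoly_eqI) simp
    then show False using False by simp
  qed
  have "linear_form a * q \<noteq> 0" using mpoly_mult_eq_0 False q by blast
  then obtain u where u: "mpeval (linear_form a * q) u \<noteq> 0" using mpoly_nonzero_somewhere by blast
  define w where "w = (1 / ?l u) *s u"
  have w: "?l w = 1" "mpeval q w \<noteq> 0"
    using u by (auto simp: w_def hom sum_divide_distrib[symmetric])
  show ?thesis
  proof (rule dvd_if_vanishes_on_hyperplane[of a j, OF j])
    \<comment> \<open>The line from \<open>w\<close> to \<open>z\<close> stays in the hyperplane, so
      \<open>f * q\<close> vanishes along it; \<open>q\<close> does not vanish at \<open>w\<close>,
      hence \<open>f\<close> vanishes on the whole line.\<close>
    fix z assume z: "?l z = 1"
    obtain g h where gh: "\<And>t. mpeval f (w + t *s (z - w)) = poly g t" "\<And>t. mpeval q (w + t *s (z - w)) = poly h t"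
      using mpeval_line by meson
    have "poly (g * h) t = poly 0 t" for t
    proof -
      obtain k where k: "f * q = (1 - linear_form a) * k" using dvd by (metis dvdE)
      have "?l (w + t *s (z - w)) = ?l w + t * (?l z - ?l w)"
        by (simp add: algebra_simps sum.distrib sum_subtractf sum_distrib_left)
      then have "mpeval (f * q) (w + t *s (z - w)) = 0" unfolding k using z w by simp
      then show ?thesis using gh by simp
    qed
    then have "g * h = 0" by (meson poly_eq_poly_eq_iff ext)
    moreover have "h \<noteq> 0" using gh(2)[of 0] w by auto
    ultimately have "g = 0" by simp
    then show "mpeval f z = 0" using gh(1)[of 1] by simp
  qed
qed simp

section \<open>Polarization and Wirtinger derivatives\<close>

text \<open>The real segment accumulates at 0, so the identity theorem applies.\<close>

lemma holomorphic_zero_if_zero_on_reals: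
  assumes g: "g holomorphic_on ball 0 s" and zero: "\<And>t::real. \<bar>t\<bar> < s \<Longrightarrow> g (of_real t) = 0"
    and w: "w \<in> ball 0 s"
  shows "g w = 0"
proof -
  have s: "s > 0" using w by (metis ball_eq_empty empty_iff not_le)
  have lim: "(0::complex) islimpt of_real ` {-s<..<s}"
    unfolding islimpt_approachable
  proof (intro allI impI)
    fix e :: real assume "e > 0"
    with s show "\<exists>x'\<in>complex_of_real ` {- s<..<s}. x' \<noteq> 0 \<and> dist x' 0 < e"
      by (intro bexI[of _ "complex_of_real (min e s / 2)"] conjI imageI)
         (auto simp: dist_norm norm_mult)
  qed
  show ?thesis
    by (rule analytic_continuation[OF g, of "of_real ` {-s<..<s}" 0])
       (use lim s zero w in \<open>auto simp: dist_norm\<close>)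
qed

text \<open>The substitution \<open>x = \<zeta> + u + \<i> v\<close>, \<open>y = cnj \<zeta> + u - \<i> v\<close> turns the diagonal \<open>y = cnj x\<close> into real
  \<open>u\<close> and \<open>v\<close>, where the identity theorem applies to one variable at a time.\<close>
lemma polarization:
  fixes K :: "complex \<Rightarrow> complex \<Rightarrow> complex"
  assumes S1: "open S1" "connected S1" and S2: "open S2" "connected S2"
    and hol: "\<And>a b c d. (\<lambda>t. K (a + b * t) (c + d * t)) holomorphic_on {t. a + b * t \<in> S1 \<and> c + d * t \<in> S2}"
    and r: "r > 0" "\<And>x. x \<in> ball \<zeta> r \<Longrightarrow> x \<in> S1" "\<And>x. x \<in> ball \<zeta> r \<Longrightarrow> cnj x \<in> S2"
    and zero: "\<And>x. x \<in> ball \<zeta> r \<Longrightarrow> K x (cnj x) = 0"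
    and xy: "x \<in> S1" "y \<in> S2"
  shows "K x y = 0"
proof -
  have in1: "\<zeta> + u + \<i> * v \<in> S1" "cnj \<zeta> + u - \<i> * v \<in> S2" "\<zeta> + u + \<i> * v \<in> ball \<zeta> r"
    if "u \<in> ball 0 (r/2)" "v \<in> ball 0 (r/2)" for u v
  proof -
    have "cmod (u + \<i> * v) \<le> cmod u + cmod v"
      using norm_triangle_ineq[of u "\<i> * v"] by (simp add: norm_mult)
    then have "dist (\<zeta> + u + \<i> * v) \<zeta> < r" using that by (simp add: dist_norm add.assoc)
    then show b: "\<zeta> + u + \<i> * v \<in> ball \<zeta> r" by (simp add: dist_commute)
    then show "\<zeta> + u + \<i> * v \<in> S1" using r by blast
    have "cmod (cnj u + \<i> * cnj v) \<le> cmod u + cmod v"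
      using norm_triangle_ineq[of "cnj u" "\<i> * cnj v"] by (simp add: norm_mult)
    then have "dist (\<zeta> + cnj u + \<i> * cnj v) \<zeta> < r" using that by (simp add: dist_norm add.assoc)
    then have "\<zeta> + cnj u + \<i> * cnj v \<in> ball \<zeta> r" by (simp add: dist_commute)
    from r(3)[OF this]
    show "cnj \<zeta> + u - \<i> * v \<in> S2" by simp
  qed
  have E1: "K (\<zeta> + of_real u + \<i> * v) (cnj \<zeta> + of_real u - \<i> * v) = 0"
    if "\<bar>u\<bar> < r/2" "v \<in> ball 0 (r/2)" for u v
  proof (rule holomorphic_zero_if_zero_on_reals[OF _ _ that(2)])
    show "(\<lambda>v. K (\<zeta> + of_real u + \<i> * v) (cnj \<zeta> + of_real u - \<i> * v)) holomorphic_on ball 0 (r/2)"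
      using hol[of "\<zeta> + of_real u" \<i> "cnj \<zeta> + of_real u" "- \<i>"]
      by (rule holomorphic_transform[OF holomorphic_on_subset])
         (use in1[of "of_real u"] that in \<open>auto simp: algebra_simps\<close>)
    show "K (\<zeta> + of_real u + \<i> * of_real t) (cnj \<zeta> + of_real u - \<i> * of_real t) = 0"
      if "\<bar>t\<bar> < r/2" for t
      using zero[OF in1(3)[of "of_real u" "of_real t"]] that \<open>\<bar>u\<bar> < r/2\<close> by simp
  qed
  have E2: "K (\<zeta> + u + \<i> * v) (cnj \<zeta> + u - \<i> * v) = 0"
    if "u \<in> ball 0 (r/2)" "v \<in> ball 0 (r/2)" for u v
  proof (rule holomorphic_zero_if_zero_on_reals[OF _ _ that(1)])
    show "(\<lambda>u. K (\<zeta> + u + \<i> * v) (cnj \<zeta> + u - \<i> * v)) holomorphic_on ball 0 (r/2)"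
      using hol[of "\<zeta> + \<i> * v" 1 "cnj \<zeta> - \<i> * v" 1]
      by (rule holomorphic_transform[OF holomorphic_on_subset])
         (use in1[of _ v] that in \<open>auto simp: algebra_simps\<close>)
  qed (use E1 that in auto)
  have E3: "K x y = 0" if "x \<in> ball \<zeta> (r/2)" "y \<in> ball (cnj \<zeta>) (r/2)" for x y
  proof -
    \<comment> \<open>The substitution solved for u and v; both have modulus below r/2 because the
      two offsets do.\<close>
    define u where "u = ((x - \<zeta>) + (y - cnj \<zeta>)) / 2"
    define v where "v = ((x - \<zeta>) - (y - cnj \<zeta>)) / (2 * \<i>)"
    have "cmod ((x - \<zeta>) + (y - cnj \<zeta>)) < r" "cmod ((x - \<zeta>) - (y - cnj \<zeta>)) < r"
      using norm_triangle_ineq[of "x - \<zeta>" "y - cnj \<zeta>"] norm_triangle_ineq4[of "x - \<zeta>" "y - cnj \<zeta>"] that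
      by (auto simp: dist_norm norm_minus_commute)
    then have "u \<in> ball 0 (r/2)" "v \<in> ball 0 (r/2)"
      by (auto simp: u_def v_def norm_divide norm_mult)
    from E2[OF this] show ?thesis
      by (simp add: u_def v_def field_simps)
  qed
  have islim: "a islimpt ball a (r/2)" for a :: complex
    using r by (intro interior_limit_point) (auto simp: interior_open)
  \<comment> \<open>The zero set now grows by the identity theorem on connected sets: first y runs
    through \<open>S2\<close>, then x through \<open>S1\<close>.\<close>
  have E4: "K x y = 0" if "x \<in> ball \<zeta> (r/2)" "y \<in> S2" for x y
  proof (rule analytic_continuation[OF _ S2, of "\<lambda>y. K x y" "ball (cnj \<zeta>) (r/2)" "cnj \<zeta>"])
    have x: "x \<in> S1" using that r by auto
    show "(\<lambda>y. K x y) holomorphic_on S2"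
      using hol[of x 0 0 1] x by simp
    show "ball (cnj \<zeta>) (r/2) \<subseteq> S2"
    proof
      fix y assume "y \<in> ball (cnj \<zeta>) (r/2)"
      moreover have "dist \<zeta> (cnj y) = dist (cnj \<zeta>) y"
        by (metis complex_cnj_cnj complex_cnj_diff complex_mod_cnj dist_norm)
      ultimately have "cnj y \<in> ball \<zeta> r" using r by simp
      then show "y \<in> S2" using r(3)[of "cnj y"] by simp
    qed
    then show "cnj \<zeta> \<in> S2" using r by auto
  qed (use that E3 islim in auto)
  show ?thesis
  proof (rule analytic_continuation[OF _ S1, of "\<lambda>x. K x y" "ball \<zeta> (r/2)" \<zeta>])
    show "(\<lambda>x. K x y) holomorphic_on S1" using hol[of 0 1 y 0] xy by simp
    show "ball \<zeta> (r/2) \<subseteq> S1" using r by auto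
    then show "\<zeta> \<in> S1" using r by auto
  qed (use xy E4 islim in auto)
qed

section \<open>Wirtinger derivatives\<close>

lemma pdir_eq:
  assumes "(g has_derivative L) (at z)"
  shows "pdir g v z = L v"
proof -
  interpret L: bounded_linear L using assms by (rule has_derivative_bounded_linear)
  have "((\<lambda>t::real. z + t *\<^sub>R v) has_derivative (\<lambda>h. h *\<^sub>R v)) (at 0)"
    by (auto intro!: derivative_eq_intros)
  from has_derivative_compose[OF this, of g L] assms
  have "((\<lambda>t::real. g (z + t *\<^sub>R v)) has_derivative (\<lambda>h. L (h *\<^sub>R v))) (at 0)" by simp
  then have "((\<lambda>t::real. g (z + t *\<^sub>R v)) has_vector_derivative L v) (at 0)"
    by (simp add: has_vector_derivative_def L.scaleR)
  then show ?thesis unfolding pdir_def by (rule vector_derivative_at)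
qed

text \<open>A real-linear map splits into a complex-linear and a conjugate-linear part. Expanding v
  in the real basis \<open>axis j 1\<close>, \<open>axis j \<i>\<close> identifies their
  coefficients as \<open>wd\<close> and \<open>wdbar\<close>.\<close>

lemma has_derivative_wirtinger:
  fixes g :: "complex^'n::finite \<Rightarrow> complex"
  assumes "g differentiable (at z)"
  shows "(g has_derivative (\<lambda>v. \<Sum>j\<in>UNIV. wd j g z * v $ j + wdbar j g z * cnj (v $ j))) (at z)"
proof -
  obtain L where L: "(g has_derivative L) (at z)" using assms by (auto simp: differentiable_def)
  interpret L: bounded_linear L using L by (rule has_derivative_bounded_linear)
  have "L v = (\<Sum>j\<in>UNIV. wd j g z * v $ j + wdbar j g z * cnj (v $ j))" for v
  proof -
    have "v = (\<Sum>j\<in>UNIV. Re (v $ j) *\<^sub>R axis j 1 + Im (v $ j) *\<^sub>R axis j \<i>)"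
      by (simp add: vec_eq_iff axis_def if_distrib sum.distrib complex_eq_iff cong: if_cong)
    then have "L v = L (\<Sum>j\<in>UNIV. Re (v $ j) *\<^sub>R axis j 1 + Im (v $ j) *\<^sub>R axis j \<i>)"
      by (rule arg_cong)
    also have "\<dots> = (\<Sum>j\<in>UNIV. Re (v $ j) *\<^sub>R L (axis j 1) + Im (v $ j) *\<^sub>R L (axis j \<i>))"
      by (simp add: L.sum L.add L.scaleR)
    also have "\<dots> = (\<Sum>j\<in>UNIV. wd j g z * v $ j + wdbar j g z * cnj (v $ j))"
      by (intro sum.cong)
         (simp_all add: wd_def wdbar_def pdir_eq[OF L] complex_eq_iff field_simps)
    finally show ?thesis .
  qed
  then show ?thesis using L by presburger
qed

text \<open>The differential of a real function is twice the real part of its complex-linear part,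
  so its two Wirtinger derivatives are conjugate.\<close>

lemma wdbar_of_real:
  fixes \<phi> :: "complex^'n::finite \<Rightarrow> real"
  assumes "(\<phi> has_derivative (\<lambda>v. 2 * Re (\<Sum>j\<in>UNIV. X j * v $ j))) (at z)"
  shows "wdbar k (\<lambda>u. complex_of_real (\<phi> u)) z = cnj (X k)"
proof -
  have "(\<Sum>j\<in>UNIV. X j * axis k c $ j) = X k * c" for c
    by (simp add: axis_def if_distrib cong: if_cong)
  then show ?thesis
    unfolding wdbar_def
    by (subst (1 2) pdir_eq[OF has_derivative_of_real[OF assms]])
       (simp add: complex_eq_iff)
qed

lemma has_derivative_cmod_power2:
  assumes "(f has_derivative D) (at z)"
  shows "((\<lambda>z. (cmod (f z))\<^sup>2) has_derivative (\<lambda>v. 2 * Re (cnj (f z) * D v))) (at z)"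
proof -
  have "((\<lambda>z. (Re (f z))\<^sup>2 + (Im (f z))\<^sup>2) has_derivative (\<lambda>v. 2 * Re (cnj (f z) * D v))) (at z)"
    by (rule derivative_eq_intros has_derivative_Re has_derivative_Im assms refl | simp add: algebra_simps)+
  then show ?thesis by (simp add: cmod_power2)
qed

lemma of_real_cmod_power2: "(complex_of_real (cmod z))\<^sup>2 = z * cnj z"
  using complex_norm_square[of z] by simp

section \<open>The unit ball, rational functions and complex lines\<close>

lemma unit_ball_eq_ball: "unit_ball = ball (0 :: complex^'n::finite) 1"
proof -
  have "(norm z)\<^sup>2 = (\<Sum>j\<in>UNIV. (cmod (z $ j))\<^sup>2)" for z :: "complex^'n"
    by (simp add: norm_vec_def L2_set_def sum_nonneg)
  moreover have "norm z < 1 \<longleftrightarrow> (norm z)\<^sup>2 < 1" for z :: "complex^'n"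
    using abs_square_less_1[of "norm z"] by simp
  ultimately show ?thesis by (auto simp: unit_ball_def)
qed

text \<open>The partial derivatives of p/r are polynomials over \<open>r * r\<close>, so the
  statement applies to them in turn.\<close>

lemma rational_has_derivative:
  fixes p r :: "'n::finite mpoly"
  shows "\<exists>p'. \<forall>z. mpeval r z \<noteq> 0 \<longrightarrow>
    ((\<lambda>z. mpeval p z / mpeval r z) has_derivative (\<lambda>v. \<Sum>j\<in>UNIV. (mpeval (p' j) z / mpeval (r * r) z) * v $ j)) (at z)"
proof -
  obtain p' where p': "\<And>z. (mpeval p has_derivative (\<lambda>v. \<Sum>j\<in>UNIV. mpeval (p' j) z * v $ j)) (at z)"
    using mpeval_has_derivative by blast
  obtain r' where r': "\<And>z. (mpeval r has_derivative (\<lambda>v. \<Sum>j\<in>UNIV. mpeval (r' j) z * v $ j)) (at z)"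
    using mpeval_has_derivative by blast
  show ?thesis
  proof (intro exI[of _ "\<lambda>j. p' j * r - p * r' j"] allI impI)
    fix z assume z: "mpeval r z \<noteq> 0"
    show "((\<lambda>z. mpeval p z / mpeval r z) has_derivative
      (\<lambda>v. \<Sum>j\<in>UNIV. (mpeval (p' j * r - p * r' j) z / mpeval (r * r) z) * v $ j)) (at z)"
      by (rule has_derivative_eq_rhs[OF has_derivative_divide'[OF p' r' z]])
         (use z in \<open>auto simp: sum_distrib_left sum_distrib_right algebra_simps simp flip: sum_subtractf sum_divide_distrib\<close>)
  qed
qed

lemma holomorphic_affine_compose:
  assumes "g holomorphic_on S"
  shows "(\<lambda>t. g (a + b * t)) holomorphic_on {t. a + b * t \<in> S \<and> Q t}"
proof -
  have "g \<circ> (\<lambda>t. a + b * t) holomorphic_on {t. a + b * t \<in> S \<and> Q t}"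
    by (rule holomorphic_on_compose_gen[OF _ assms]) (auto intro!: holomorphic_intros)
  then show ?thesis by (simp add: o_def)
qed

lemma bounded_linear_scalar_vector: "bounded_linear (\<lambda>h::complex. h *s (b :: complex^'n::finite))"
  by (intro bounded_linear_intro[of _ "norm b"])
     (auto simp: vec_eq_iff algebra_simps norm_vector_scalar_mult)

lemma has_field_derivative_line:
  fixes g :: "complex^'n::finite \<Rightarrow> complex"
  assumes "(g has_derivative L) (at (a + x *s b))" and lin: "\<And>h. L (h *s b) = h * d"
  shows "((\<lambda>x. g (a + x *s b)) has_field_derivative d) (at x)"
proof -
  have "((\<lambda>x::complex. a + x *s b) has_derivative (\<lambda>h. 0 + h *s b)) (at x)"
    by (intro has_derivative_add has_derivative_const bounded_linear_imp_has_derivative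
        bounded_linear_scalar_vector)
  from has_derivative_compose[OF this, of g L] assms
  have "((\<lambda>x. g (a + x *s b)) has_derivative (\<lambda>h. L (h *s b))) (at x)" by simp
  then show ?thesis by (simp add: has_field_derivative_def lin mult.commute[of _ d])
qed

lemma continuous_scalar_line: "continuous_on S (\<lambda>x::complex. a + x *s (b :: complex^'n::finite))"
  by (intro continuous_intros linear_continuous_on bounded_linear_scalar_vector)

lemma line_in_unit_ball:
  "open {x. a + x *s (b :: complex^'n::finite) \<in> unit_ball}" (is ?A)
  "connected {x. a + x *s (b :: complex^'n::finite) \<in> unit_ball}" (is ?B)
proof -
  have e: "{x. a + x *s b \<in> unit_ball} = (\<lambda>x. a + x *s b) -` ball 0 1" by (auto simp: unit_ball_eq_ball)
  show ?A unfolding e by (intro open_vimage continuous_scalar_line) auto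
  have "convex ((\<lambda>x. a + x *s b) -` ball 0 1)"
  proof (rule convexI)
    fix x y :: complex and u v :: real
    assume *: "x \<in> (\<lambda>x. a + x *s b) -` ball 0 1" "y \<in> (\<lambda>x. a + x *s b) -` ball 0 1" "0 \<le> u" "0 \<le> v" "u + v = 1"
    have "a + (u *\<^sub>R x + v *\<^sub>R y) *s b = u *\<^sub>R (a + x *s b) + v *\<^sub>R (a + y *s b)"
    proof -
      have v: "v = 1 - u" using *(5) by simp
      show ?thesis unfolding v by (simp add: vec_eq_iff scaleR_conv_of_real[where 'a=complex] algebra_simps)
    qed
    then show "u *\<^sub>R x + v *\<^sub>R y \<in> (\<lambda>x. a + x *s b) -` ball 0 1"
      using convexD[OF convex_ball, of "a + x *s b" 0 1 "a + y *s b" u v] * by auto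
  qed
  then show ?B unfolding e by (rule convex_connected)
qed

text \<open>Orders of vanishing at r = 1 are compared: \<open>A\<close> and \<open>B\<close>
  contribute integral powers of 1 - r and all other factors have nonzero limits, so the leftover
  exponent of 1 - r must be 0.\<close>

lemma powr_rational_imp_nat:
  fixes A B :: "real poly"
  assumes B: "B \<noteq> 0" and mu: "mu > 0"
    and eq: "\<And>r. r \<in> {0<..<1} \<Longrightarrow> poly B r \<noteq> 0 \<Longrightarrow> poly A r = poly B r * (1 - r\<^sup>2) powr mu"
  shows "\<exists>k::nat. mu = real k"
proof -
  have evB: "eventually (\<lambda>r. r \<in> {0<..<1} \<and> poly B r \<noteq> 0) (at_left (1::real))"
  proof (rule eventually_conj)
    show "eventually (\<lambda>r. r \<in> {0<..<1}) (at_left (1::real))"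
      by (rule eventually_at_leftI[of 0]) auto
    have "eventually (\<lambda>r. r \<notin> {r. poly B r = 0}) (at (1::real))"
      using islimpt_finite[OF poly_roots_finite[OF B], of 1] by (simp add: islimpt_iff_eventually)
    then show "eventually (\<lambda>r. poly B r \<noteq> 0) (at_left (1::real))"
      by (auto simp: eventually_at_filter elim: eventually_mono)
  qed
  then obtain r0 where r0: "r0 \<in> {0<..<1}" "poly B r0 \<noteq> 0"
    using eventually_happens'[OF trivial_limit_at_left_real] by blast
  have "(1 - r0\<^sup>2) > 0" using r0 by (simp add: power_less_one_iff)
  then have "poly A r0 \<noteq> 0" using eq[OF r0] r0 by simp
  then have A: "A \<noteq> 0" by auto
  obtain A1 where A1: "A = [:-1, 1:] ^ order 1 A * A1" "\<not> [:-1, 1:] dvd A1"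
    using order_decomp[OF A, of 1] by auto
  obtain B1 where B1: "B = [:-1, 1:] ^ order 1 B * B1" "\<not> [:-1, 1:] dvd B1"
    using order_decomp[OF B, of 1] by auto
  define a b where "a = order 1 A" and "b = order 1 B"
  have ne: "poly A1 1 \<noteq> 0" "poly B1 1 \<noteq> 0" using A1(2) B1(2) by (simp_all add: poly_eq_0_iff_dvd)
  \<comment> \<open>\<open>e\<close> is the net exponent of 1 - r once the roots of \<open>A\<close>
    and \<open>B\<close> at 1 are split off; \<open>q\<close> collects the rest, with a finite
    nonzero limit at 1.\<close>
  define e where "e = mu + real b - real a"
  define q where "q r = \<bar>poly A1 r\<bar> / (\<bar>poly B1 r\<bar> * (1 + r) powr mu)" for r
  have lim: "(q \<longlongrightarrow> q 1) (at_left 1)"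
    unfolding q_def using ne by (intro tendsto_intros) auto
  have q1: "q 1 \<noteq> 0" unfolding q_def using ne by simp
  have ev: "eventually (\<lambda>r. (1 - r) powr e = q r) (at_left 1)"
    using evB
  proof eventually_elim
    case (elim r)
    then have r: "0 < r" "r < 1" by auto
    have pw: "\<bar>(r - 1) ^ n\<bar> = (1 - r) powr real n" for n
      using r by (simp add: powr_realpow power_abs)
    have "\<bar>poly A r\<bar> = (1 - r) powr a * \<bar>poly A1 r\<bar>"
      by (subst A1(1)) (simp add: poly_power abs_mult a_def pw[symmetric] algebra_simps)
    moreover have "\<bar>poly B r\<bar> = (1 - r) powr b * \<bar>poly B1 r\<bar>"
      by (subst B1(1)) (simp add: poly_power abs_mult b_def pw[symmetric] algebra_simps)
    moreover have "poly A r = poly B r * (1 - r\<^sup>2) powr mu" using eq elim by blast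
    moreover have "1 - r\<^sup>2 = (1 - r) * (1 + r)" by (simp add: power2_eq_square algebra_simps)
    ultimately have h1: "(1 - r) powr a * \<bar>poly A1 r\<bar> = (1 - r) powr b * \<bar>poly B1 r\<bar> * ((1 - r) powr mu * (1 + r) powr mu)"
      using r by (simp add: abs_mult powr_mult)
    have h2: "(1 - r) powr e = (1 - r) powr mu * (1 - r) powr b / (1 - r) powr a"
      using r by (simp add: e_def powr_diff powr_add)
    have nz: "\<bar>poly B1 r\<bar> \<noteq> 0" "(1 - r) powr a \<noteq> 0" "(1 + r) powr mu \<noteq> 0"
      using elim r by (auto simp: B1(1)[unfolded b_def[symmetric]] dest: arg_cong[where f="\<lambda>p. poly p r"])
    have "\<bar>poly A1 r\<bar> = (1 - r) powr b * \<bar>poly B1 r\<bar> * ((1 - r) powr mu * (1 + r) powr mu) / (1 - r) powr a"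
      using h1 nz by (simp add: field_simps)
    then show ?case unfolding q_def h2 using nz by simp
  qed
  have lime: "((\<lambda>r. (1 - r) powr e) \<longlongrightarrow> q 1) (at_left 1)"
    using Lim_transform_eventually[OF lim] ev by (simp add: eq_commute)
  have "e = 0"
  proof (rule ccontr)
    assume "e \<noteq> 0"
    then consider "e > 0" | "e < 0" by linarith
    then show False
    proof cases
      case 1
      then have "((\<lambda>r. (1 - r) powr e) \<longlongrightarrow> 0) (at_left (1::real))" by real_asymp
      then show False using lime q1 tendsto_unique trivial_limit_at_left_real by blast
    next
      case 2
      then have "((\<lambda>r. (1 - r) powr (- e)) \<longlongrightarrow> 0) (at_left (1::real))" by real_asymp
      moreover have "((\<lambda>r. inverse ((1 - r) powr e)) \<longlongrightarrow> inverse (q 1)) (at_left 1)"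
        using lime q1 by (rule tendsto_inverse)
      ultimately have "inverse (q 1) = 0"
        unfolding powr_minus by (intro tendsto_unique[OF trivial_limit_at_left_real])
      then show False using q1 by simp
    qed
  qed
  \<comment> \<open>Positivity of \<open>mu\<close> gives a > b, so the subtraction of naturals is
    exact.\<close>
  then have "mu = real (a - b)" using mu by (simp add: e_def of_nat_diff)
  then show ?thesis by blast
qed

text \<open>On the real axis the real and imaginary parts of a complex polynomial are real
  polynomials.\<close>

lemma cmod_power2_poly_of_real: "\<exists>q::real poly. \<forall>r. (cmod (poly p (of_real r)))\<^sup>2 = poly q r"
proof -
  have "Re (poly p (of_real r)) = poly (map_poly Re p) r \<and> Im (poly p (of_real r)) = poly (map_poly Im p) r" for r
    by (induction p) (auto simp: map_poly_pCons)
  then show ?thesis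
    by (intro exI[of _ "(map_poly Re p)\<^sup>2 + (map_poly Im p)\<^sup>2"]) (simp add: cmod_power2)
qed

lemma second_derivatives_unique:
  fixes u w :: "complex \<Rightarrow> complex"
  assumes S: "open S" "x0 \<in> S"
    and eq: "\<And>x. x \<in> S \<Longrightarrow> u x = w x"
    and u1: "\<And>x. x \<in> S \<Longrightarrow> (u has_field_derivative u1 x) (at x)"
    and w1: "\<And>x. x \<in> S \<Longrightarrow> (w has_field_derivative w1 x) (at x)"
    and u2: "(u1 has_field_derivative u2) (at x0)" and w2: "(w1 has_field_derivative w2) (at x0)"
  shows "u2 = w2"
proof -
  have "u1 x = w1 x" if "x \<in> S" for x
    using has_field_derivative_transform_within_open[OF u1[OF that] S(1) that eq] w1[OF that] DERIV_unique by blast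
  from has_field_derivative_transform_within_open[OF u2 S this] w2 show ?thesis
    using DERIV_unique by blast
qed

text \<open>On the plane of two coordinate vectors the form at s e1 + e2 is a quadratic polynomial
  in s. It has a complex root unless its leading coefficient is 0, and then e1 is isotropic.\<close>

lemma complex_quadratic_form_isotropic:
  fixes L :: "complex^'n::finite \<Rightarrow> complex^'m::finite"
  assumes card: "CARD('n) \<ge> 2" and add: "\<And>u v. L (u + v) = L u + L v" and sc: "\<And>c v. L (c *s v) = c *s L v"
  shows "\<exists>v. norm v = 1 \<and> (\<Sum>i\<in>UNIV. (L v $ i)\<^sup>2) = 0"
proof -
  obtain j1 j2 :: 'n where j: "j1 \<noteq> j2"
    using card by (metis One_nat_def card_2_iff' card_le_Suc0_iff_eq finite_class.finite_UNIV iso_tuple_UNIV_I not_less_eq_eq numeral_2_eq_2)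
  let ?e1 = "axis j1 1 :: complex^'n" and ?e2 = "axis j2 1 :: complex^'n"
  define \<alpha> where "\<alpha> = (\<Sum>i\<in>UNIV. (L ?e1 $ i)\<^sup>2)"
  define \<beta> where "\<beta> = (\<Sum>i\<in>UNIV. L ?e1 $ i * L ?e2 $ i)"
  define \<gamma> where "\<gamma> = (\<Sum>i\<in>UNIV. (L ?e2 $ i)\<^sup>2)"
  have "\<exists>v. v \<noteq> 0 \<and> (\<Sum>i\<in>UNIV. (L v $ i)\<^sup>2) = 0"
  proof (cases "\<alpha> = 0")
    case True
    then show ?thesis by (intro exI[of _ ?e1]) (simp add: \<alpha>_def)
  next
    case False
    define s where "s = (csqrt (\<beta>\<^sup>2 - \<alpha> * \<gamma>) - \<beta>) / \<alpha>"
    let ?v = "s *s ?e1 + ?e2"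
    have "(\<Sum>i\<in>UNIV. (L ?v $ i)\<^sup>2) = \<alpha> * s\<^sup>2 + 2 * \<beta> * s + \<gamma>"
      by (simp add: add sc \<alpha>_def \<beta>_def \<gamma>_def power2_eq_square algebra_simps sum.distrib sum_distrib_left)
    also have "\<dots> = ((\<alpha> * s + \<beta>)\<^sup>2 - (\<beta>\<^sup>2 - \<alpha> * \<gamma>)) / \<alpha>"
      using False by (simp add: field_simps power2_eq_square)
    also have "\<alpha> * s + \<beta> = csqrt (\<beta>\<^sup>2 - \<alpha> * \<gamma>)" using False by (simp add: s_def)
    finally have "(\<Sum>i\<in>UNIV. (L ?v $ i)\<^sup>2) = 0" by simp
    moreover have "?v $ j2 = 1" using j by (simp add: axis_def)
    then have "?v \<noteq> 0" by (metis zero_index zero_neq_one)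
    ultimately show ?thesis by blast
  qed
  then obtain v where v: "v \<noteq> 0" "(\<Sum>i\<in>UNIV. (L v $ i)\<^sup>2) = 0" by blast
  show ?thesis
  proof (intro exI conjI)
    let ?c = "complex_of_real (inverse (norm v))"
    show "norm (?c *s v) = 1" using v by (simp add: norm_vector_scalar_mult norm_inverse)
    show "(\<Sum>i\<in>UNIV. (L (?c *s v) $ i)\<^sup>2) = 0"
      using v(2) by (simp add: sc power_mult_distrib flip: sum_distrib_left)
  qed
qed

lemma rdeg_le_iff: "rdeg P R \<le> d \<longleftrightarrow> (\<forall>i. mdeg (P $ i) \<le> d) \<and> mdeg R \<le> d"
  unfolding rdeg_def by (subst max.bounded_iff, subst Max_le_iff) auto

text \<open>The quadratic is (1 - l t)^2 - d t^2. For nonzero d it has a simple root, where its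
  product with a square has odd order, while the order of a square is even.\<close>

lemma not_square_of_rational:
  fixes X Y :: "complex poly"
  assumes d: "d \<noteq> 0" and Y: "Y \<noteq> 0"
    and eq: "X\<^sup>2 = [:1, - 2 * l, l\<^sup>2 - d:] * Y\<^sup>2"
  shows False
proof -
  let ?D = "[:1, - 2 * l, l\<^sup>2 - d:]"
  \<comment> \<open>The simple root is 1/(2l) when the degree drops, and otherwise (l + w)/(l^2 - d)
    with w a square root of d; there the derivative equals 2w.\<close>
  have "\<exists>t. poly ?D t = 0 \<and> poly (pderiv ?D) t \<noteq> 0"
  proof (cases "l\<^sup>2 - d = 0")
    case True
    then have "l \<noteq> 0" using d by auto
    then show ?thesis using True by (intro exI[of _ "1 / (2 * l)"]) (auto simp: pderiv_pCons)
  next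
    case False
    define c where "c = l\<^sup>2 - d"
    define w where "w = csqrt d"
    have w: "w\<^sup>2 = d" "w \<noteq> 0" using d by (auto simp: w_def)
    define t where "t = (l + w) / c"
    have c0: "c \<noteq> 0" using False by (simp add: c_def)
    have "c * t = l + w" using c0 by (simp add: t_def)
    have "c * poly ?D t = c - 2 * l * (c * t) + (c * t)\<^sup>2"
      unfolding c_def[symmetric] by (simp add: algebra_simps power2_eq_square)
    also have "\<dots> = 0" unfolding \<open>c * t = l + w\<close> by (simp add: c_def w(1)[symmetric] algebra_simps power2_eq_square)
    finally have "poly ?D t = 0" using c0 by simp
    moreover have "poly (pderiv ?D) t = 2 * (c * t) - 2 * l"
      unfolding c_def[symmetric] by (simp add: pderiv_pCons algebra_simps)
    then have "poly (pderiv ?D) t \<noteq> 0" unfolding \<open>c * t = l + w\<close> using w by simp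
    ultimately show ?thesis by blast
  qed
  then obtain t where t: "poly ?D t = 0" "poly (pderiv ?D) t \<noteq> 0" by blast
  have D0: "?D \<noteq> 0" by simp
  have "order t ?D = Suc (order t (pderiv ?D))"
    using t D0 by (intro order_pderiv) (auto simp: order_root)
  also have "order t (pderiv ?D) = 0" using t(2) by (rule order_0I)
  finally have o: "order t ?D = 1" by simp
  have "?D * Y\<^sup>2 \<noteq> 0" using D0 Y by (metis mult_eq_0_iff power_not_zero)
  then have "order t (?D * Y\<^sup>2) = order t ?D + order t (Y\<^sup>2)" by (rule order_mult)
  then have "order t (?D * Y\<^sup>2) = 1 + 2 * order t Y"
    unfolding o using Y by (simp add: order_mult power2_eq_square)
  moreover have "X \<noteq> 0" using eq \<open>?D * Y\<^sup>2 \<noteq> 0\<close> by auto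
  then have "order t (X\<^sup>2) = 2 * order t X" by (simp add: order_mult power2_eq_square)
  ultimately show False unfolding eq by presburger
qed

section \<open>The functional equation of a rational isometry\<close>

locale rational_isometry =
  fixes F :: "complex^'n::finite \<Rightarrow> complex^'m::finite"
    and P :: "('n mpoly)^'m" and R :: "'n mpoly" and c c' lam :: real
  assumes c: "c > 0" and c': "c' > 0" and lam: "lam > 0"
    and isometry: "holo_isometry c c' F lam"
    and rational: "rational_rep F P R"
    and F0: "F 0 = 0"
begin

text \<open>The formula P/R is available only off the zeros of \<open>R\<close>. The differential
  identities are derived on this open set and then reach the whole ball by continuity.\<close>

definition U :: "(complex^'n) set" where "U = {z \<in> unit_ball. mpeval R z \<noteq> 0}"

definition FF :: "complex^'n \<Rightarrow> complex" where "FF z = (\<Sum>i\<in>UNIV. (F z $ i)\<^sup>2)"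

definition N :: "complex^'n \<Rightarrow> real" where
  "N z = 1 - (\<Sum>i\<in>UNIV. (cmod (F z $ i))\<^sup>2) + (cmod (FF z))\<^sup>2 / 4"

definition M :: "complex^'n \<Rightarrow> real" where
  "M z = 1 - (\<Sum>j\<in>UNIV. (cmod (z $ j))\<^sup>2)"

text \<open>The logarithms of the two kernels carry the factors -m on log N and -(n+1) on log M; the
  isometry therefore compares log N with this multiple of log M.\<close>

definition mu :: real where "mu = lam * real (CARD('n) + 1) / real CARD('m)"

lemma mu_pos: "mu > 0"
  using lam by (simp add: mu_def)

lemma FF_0: "FF 0 = 0"
  by (simp add: FF_def F0)

lemma N_pos: "z \<in> unit_ball \<Longrightarrow> N z > 0"
  using isometry by (auto simp: holo_isometry_def typeIV_domain_def N_def FF_def image_subset_iff)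

lemma M_pos: "z \<in> unit_ball \<Longrightarrow> M z > 0"
  by (auto simp: unit_ball_def M_def)

lemma F_has_derivative:
  assumes "z \<in> unit_ball"
  obtains L where "(F has_derivative L) (at z)" "\<And>c v. L (c *s v) = c *s L v"
  using isometry assms unfolding holo_isometry_def holo_on_def by blast

lemma component_has_derivative:
  "(F has_derivative L) G \<Longrightarrow> ((\<lambda>z. F z $ i) has_derivative (\<lambda>v. L v $ i)) G"
  by (rule bounded_linear.has_derivative[OF bounded_linear_vec_nth])

text \<open>Supplies the one-variable holomorphic functions to which polarization is
  applied.\<close>

lemma F_line_holomorphic:
  "(\<lambda>x. F (a + x *s b) $ i) holomorphic_on {x. a + x *s b \<in> unit_ball}"
proof (rule holomorphic_onI)
  fix x assume "x \<in> {x. a + x *s b \<in> unit_ball}"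
  then have "a + x *s b \<in> unit_ball" by simp
  then obtain L where L: "(F has_derivative L) (at (a + x *s b))" "\<And>c v. L (c *s v) = c *s L v"
    using F_has_derivative by blast
  have "((\<lambda>x. F (a + x *s b) $ i) has_field_derivative (L b $ i)) (at x)"
    by (rule has_field_derivative_line[OF component_has_derivative[OF L(1)]]) (simp add: L)
  then show "(\<lambda>x. F (a + x *s b) $ i) field_differentiable (at x within {x. a + x *s b \<in> unit_ball})"
    using field_differentiable_at_within field_differentiable_def by blast
qed

lemma continuous_F: "continuous_on unit_ball F"
proof (rule continuous_at_imp_continuous_on, rule)
  fix z :: "complex^'n" assume "z \<in> unit_ball"
  then obtain L where "(F has_derivative L) (at z)" by (rule F_has_derivative)
  then show "isCont F z" by (rule has_derivative_continuous)
qed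

lemma continuous_N: "continuous_on unit_ball N" and continuous_M: "continuous_on unit_ball M"
proof -
  show "continuous_on unit_ball N"
    unfolding N_def FF_def by (intro continuous_intros continuous_F) auto
  show "continuous_on unit_ball M"
    unfolding M_def by (intro continuous_intros)
qed

lemma open_U: "open U"
proof -
  have "continuous_on UNIV (mpeval R)" unfolding mpeval_def by (intro continuous_intros)
  then have "open (mpeval R -` (- {0}))" by (intro open_vimage) auto
  moreover have "U = ball 0 1 \<inter> mpeval R -` (- {0})" by (auto simp: U_def unit_ball_eq_ball)
  ultimately show ?thesis by auto
qed

lemma R_nonzero: "R \<noteq> 0"
  using rational by (auto simp: rational_rep_def lowest_terms_rep_def)

lemma F_rational: "z \<in> U \<Longrightarrow> F z $ i = mpeval (P $ i) z / mpeval R z"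
  using rational by (auto simp: rational_rep_def U_def)

text \<open>The partial derivatives of \<open>F\<close>; specified on \<open>U\<close> only.\<close>
definition DF :: "'m \<Rightarrow> 'n \<Rightarrow> complex^'n \<Rightarrow> complex" where
  "DF = (SOME D. \<forall>i. \<forall>z\<in>U. ((\<lambda>z. F z $ i) has_derivative (\<lambda>v. \<Sum>j\<in>UNIV. D i j z * v $ j)) (at z) \<and>
     (\<forall>j. \<exists>d. (D i j has_derivative (\<lambda>v. \<Sum>k\<in>UNIV. d k * v $ k)) (at z)))"

lemma DF:
  "\<forall>i. \<forall>z\<in>U. ((\<lambda>z. F z $ i) has_derivative (\<lambda>v. \<Sum>j\<in>UNIV. DF i j z * v $ j)) (at z) \<and>
     (\<forall>j. \<exists>d. (DF i j has_derivative (\<lambda>v. \<Sum>k\<in>UNIV. d k * v $ k)) (at z))"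
proof -
  have "\<forall>i. \<exists>p'. \<forall>z. mpeval R z \<noteq> 0 \<longrightarrow> ((\<lambda>z. mpeval (P $ i) z / mpeval R z) has_derivative
      (\<lambda>v. \<Sum>j\<in>UNIV. (mpeval (p' j) z / mpeval (R * R) z) * v $ j)) (at z)"
    using rational_has_derivative by blast
  from choice[OF this] obtain p' where p': "\<And>i z. mpeval R z \<noteq> 0 \<Longrightarrow>
      ((\<lambda>z. mpeval (P $ i) z / mpeval R z) has_derivative
      (\<lambda>v. \<Sum>j\<in>UNIV. (mpeval (p' i j) z / mpeval (R * R) z) * v $ j)) (at z)"
    by blast
  have "\<exists>D. \<forall>i. \<forall>z\<in>U. ((\<lambda>z. F z $ i) has_derivative (\<lambda>v. \<Sum>j\<in>UNIV. D i j z * v $ j)) (at z) \<and>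
     (\<forall>j. \<exists>d. (D i j has_derivative (\<lambda>v. \<Sum>k\<in>UNIV. d k * v $ k)) (at z))"
  proof (intro exI[of _ "\<lambda>i j z. mpeval (p' i j) z / mpeval (R * R) z"] allI ballI conjI)
    fix i z assume z: "z \<in> U"
    then have "mpeval R z \<noteq> 0" by (simp add: U_def)
    from has_derivative_transform_within_open[OF p'[OF this] open_U z]
    show "((\<lambda>z. F z $ i) has_derivative (\<lambda>v. \<Sum>j\<in>UNIV. mpeval (p' i j) z / mpeval (R * R) z * v $ j)) (at z)"
      by (simp add: F_rational)
    fix j
    have "mpeval (R * R) z \<noteq> 0" using z by (simp add: U_def)
    moreover obtain q where "\<And>z. mpeval (R * R) z \<noteq> 0 \<Longrightarrow>
        ((\<lambda>z. mpeval (p' i j) z / mpeval (R * R) z) has_derivative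
        (\<lambda>v. \<Sum>k\<in>UNIV. (mpeval (q k) z / mpeval (R * R * (R * R)) z) * v $ k)) (at z)"
      using rational_has_derivative[of "R * R" "p' i j"] by blast
    ultimately show "\<exists>d. ((\<lambda>z. mpeval (p' i j) z / mpeval (R * R) z) has_derivative (\<lambda>v. \<Sum>k\<in>UNIV. d k * v $ k)) (at z)"
      by (intro exI[of _ "\<lambda>k. mpeval (q k) z / mpeval (R * R * (R * R)) z"])
  qed
  from someI_ex[OF this] show ?thesis unfolding DF_def .
qed

lemmas F_DF = DF[rule_format, THEN conjunct1]
lemmas DF_has_derivative = DF[rule_format, THEN conjunct2, rule_format]

text \<open>The Wirtinger derivative of \<open>N\<close> with respect to \<open>z\<^sub>k\<close>.\<close>
definition XN :: "'n \<Rightarrow> complex^'n \<Rightarrow> complex" where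
  "XN k z = - (\<Sum>i\<in>UNIV. cnj (F z $ i) * DF i k z) + cnj (FF z) * (\<Sum>i\<in>UNIV. F z $ i * DF i k z) / 2"

lemma N_has_derivative:
  assumes "z \<in> U"
  shows "(N has_derivative (\<lambda>v. 2 * Re (\<Sum>k\<in>UNIV. XN k z * v $ k))) (at z)"
proof -
  define D where "D i v = (\<Sum>j\<in>UNIV. DF i j z * v $ j)" for i and v :: "complex^'n"
  have D: "((\<lambda>z. F z $ i) has_derivative D i) (at z)" for i
    using F_DF[OF assms] unfolding D_def .
  have FFd: "(FF has_derivative (\<lambda>v. 2 * (\<Sum>i\<in>UNIV. F z $ i * D i v))) (at z)"
    unfolding FF_def
    by (rule derivative_eq_intros D refl | simp add: sum_distrib_left algebra_simps)+
  have "(N has_derivative (\<lambda>v. 0 - (\<Sum>i\<in>UNIV. 2 * Re (cnj (F z $ i) * D i v))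
     + 2 * Re (cnj (FF z) * (2 * (\<Sum>i\<in>UNIV. F z $ i * D i v))) / 4)) (at z)"
    unfolding N_def
    by (intro has_derivative_add has_derivative_diff has_derivative_const has_derivative_sum
       has_derivative_cmod_power2 D FFd bounded_linear.has_derivative[OF bounded_linear_divide])
  moreover have "0 - (\<Sum>i\<in>UNIV. 2 * Re (cnj (F z $ i) * D i v))
     + 2 * Re (cnj (FF z) * (2 * (\<Sum>i\<in>UNIV. F z $ i * D i v))) / 4
     = 2 * Re (\<Sum>k\<in>UNIV. XN k z * v $ k)" for v
  proof -
    have "(\<Sum>k\<in>UNIV. XN k z * v $ k) = - (\<Sum>k\<in>UNIV. \<Sum>i\<in>UNIV. cnj (F z $ i) * (DF i k z * v $ k))
       + cnj (FF z) * (\<Sum>k\<in>UNIV. \<Sum>i\<in>UNIV. F z $ i * (DF i k z * v $ k)) / 2"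
      by (simp add: XN_def algebra_simps sum.distrib sum_subtractf sum_negf sum_distrib_left sum_distrib_right sum_divide_distrib)
    also have "\<dots> = - (\<Sum>i\<in>UNIV. cnj (F z $ i) * D i v) + cnj (FF z) * (\<Sum>i\<in>UNIV. F z $ i * D i v) / 2"
      unfolding D_def by (subst (1 2) sum.swap) (simp add: sum_distrib_left)
    finally have "2 * Re (\<Sum>k\<in>UNIV. XN k z * v $ k)
      = 2 * Re (- (\<Sum>i\<in>UNIV. cnj (F z $ i) * D i v) + cnj (FF z) * (\<Sum>i\<in>UNIV. F z $ i * D i v) / 2)"
      by (rule arg_cong)
    also have "\<dots> = 0 - 2 * Re (\<Sum>i\<in>UNIV. cnj (F z $ i) * D i v)
         + 2 * Re (cnj (FF z) * (2 * (\<Sum>i\<in>UNIV. F z $ i * D i v))) / 4"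
      by (simp add: algebra_simps del: Re_sum)
    finally show ?thesis by (simp add: sum_distrib_left)
  qed
  ultimately show ?thesis by simp
qed

lemma M_has_derivative: "(M has_derivative (\<lambda>v. 2 * Re (\<Sum>k\<in>UNIV. - cnj (z $ k) * v $ k))) (at z)"
proof -
  have "(M has_derivative (\<lambda>v. 0 - (\<Sum>i\<in>UNIV. 2 * Re (cnj (z $ i) * v $ i)))) (at z)"
    unfolding M_def
    by (intro has_derivative_diff has_derivative_const has_derivative_sum has_derivative_cmod_power2
        bounded_linear_imp_has_derivative bounded_linear_vec_nth)
  then show ?thesis by (simp add: sum_distrib_left sum_negf)
qed

lemma ln_has_derivative:
  fixes f :: "complex^'n \<Rightarrow> real"
  assumes "(f has_derivative (\<lambda>v. 2 * Re (\<Sum>k\<in>UNIV. X k * v $ k))) (at z)" "f z > 0"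
  shows "((\<lambda>z. a + b * ln (f z)) has_derivative (\<lambda>v. 2 * Re (\<Sum>k\<in>UNIV. (of_real b * X k / of_real (f z)) * v $ k))) (at z)"
proof -
  have "((\<lambda>z. a + b * ln (f z)) has_derivative (\<lambda>v. b * (2 * Re (\<Sum>k\<in>UNIV. X k * v $ k) / f z))) (at z)"
    using assms(2) by (auto intro!: derivative_eq_intros assms(1) simp: divide_inverse)
  moreover have "b * (2 * Re (\<Sum>k\<in>UNIV. X k * v $ k) / f z)
     = 2 * Re (\<Sum>k\<in>UNIV. (of_real b * X k / of_real (f z)) * v $ k)" for v
  proof -
    have "(\<Sum>k\<in>UNIV. (of_real b * X k / of_real (f z)) * v $ k) = of_real (b / f z) * (\<Sum>k\<in>UNIV. X k * v $ k)"
      by (simp add: sum_distrib_left algebra_simps)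
    then show ?thesis by (simp del: Re_sum of_real_divide)
  qed
  ultimately show ?thesis by simp
qed

section \<open>From the isometry condition to the vanishing differential of the log ratio\<close>

lemma wdbar_ln_K_IV:
  assumes "z \<in> U"
  shows "wdbar k (\<lambda>u. complex_of_real (ln (K_IV c' (F u)))) z = cnj (- of_nat CARD('m) * XN k z / of_real (N z))"
proof -
  have z: "z \<in> unit_ball" using assms by (simp add: U_def)
  have ln: "ln c' + (- real CARD('m)) * ln (N u) = ln (K_IV c' (F u))" if "u \<in> U" for u
  proof -
    have "N u > 0" using that N_pos by (simp add: U_def)
    moreover have "K_IV c' (F u) = c' * N u powr (- real CARD('m))"
      by (simp add: K_IV_def N_def FF_def)
    ultimately show ?thesis using c' by (simp add: ln_mult)
  qed
  have "((\<lambda>u. ln (K_IV c' (F u))) has_derivative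
     (\<lambda>v. 2 * Re (\<Sum>k\<in>UNIV. (of_real (- real CARD('m)) * XN k z / of_real (N z)) * v $ k))) (at z)"
    by (rule has_derivative_transform_within_open[OF ln_has_derivative[OF N_has_derivative[OF assms] N_pos[OF z]] open_U assms ln])
  from wdbar_of_real[OF this] show ?thesis by simp
qed

lemma wdbar_ln_K_ball:
  assumes "z \<in> unit_ball"
  shows "wdbar k (\<lambda>u. complex_of_real (ln (K_ball c u))) z = cnj (of_nat (CARD('n) + 1) * cnj (z $ k) / of_real (M z))"
proof -
  have ln: "ln c + (- real (CARD('n) + 1)) * ln (M u) = ln (K_ball c u)" if "u \<in> unit_ball" for u
  proof -
    have "M u > 0" using that M_pos by simp
    moreover have "K_ball c u = c * M u powr (- real (CARD('n) + 1))"
      by (simp add: K_ball_def M_def)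
    ultimately show ?thesis using c by (simp add: ln_mult)
  qed
  have "open (unit_ball :: (complex^'n) set)" by (simp add: unit_ball_eq_ball)
  have "((\<lambda>u. ln (K_ball c u)) has_derivative
     (\<lambda>v. 2 * Re (\<Sum>k\<in>UNIV. (of_real (- real (CARD('n) + 1)) * (- cnj (z $ k)) / of_real (M z)) * v $ k))) (at z)"
    by (rule has_derivative_transform_within_open[OF ln_has_derivative[OF M_has_derivative M_pos[OF assms]] \<open>open unit_ball\<close> assms ln])
  from wdbar_of_real[OF this] show ?thesis by (simp add: algebra_simps)
qed

text \<open>The Wirtinger derivative of \<open>ln N - mu * ln M\<close>. The isometry condition says exactly that it is
  holomorphic.\<close>
definition chi :: "'n \<Rightarrow> complex^'n \<Rightarrow> complex" where
  "chi k z = XN k z / of_real (N z) + of_real mu * cnj (z $ k) / of_real (M z)"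

text \<open>The isometry makes the \<open>wd\<close> derivatives of the difference
  \<open>e1 - lam * e2\<close> vanish. Its differential is thus conjugate-linear, and its conjugate,
  which is -m times \<open>chi\<close>, has a complex-linear differential.\<close>

lemma chi_has_derivative:
  assumes z: "z \<in> U"
  shows "\<exists>d. (chi k has_derivative (\<lambda>v. \<Sum>j\<in>UNIV. d j * v $ j)) (at z)"
proof -
  have zb: "z \<in> unit_ball" using z by (simp add: U_def)
  let ?m = "of_nat CARD('m) :: complex" and ?n = "of_nat (CARD('n) + 1) :: complex"
  define e1 where "e1 = (\<lambda>w. wdbar k (\<lambda>u. complex_of_real (ln (K_IV c' (F u)))) w)"
  define e2 where "e2 = (\<lambda>w. wdbar k (\<lambda>u. complex_of_real (ln (K_ball c u))) w)"
  \<comment> \<open>Real differentiability of \<open>e1\<close> and \<open>e2\<close> comes first: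
    only then do \<open>wd\<close> and \<open>wdbar\<close> determine the differential.\<close>
  have F_diff: "(\<lambda>w. F w $ i) differentiable (at z)" for i
    using F_DF[OF z] by (auto simp: differentiable_def)
  have DF_diff: "DF i j differentiable (at z)" for i j
    using DF_has_derivative[OF z] unfolding differentiable_def by blast
  have N_diff: "(\<lambda>w. complex_of_real (N w)) differentiable (at z)"
    using has_derivative_of_real[OF N_has_derivative[OF z]] unfolding differentiable_def by blast
  have M_diff: "(\<lambda>w. complex_of_real (M w)) differentiable (at z)"
    using has_derivative_of_real[OF M_has_derivative] unfolding differentiable_def by blast
  have nth_diff: "(\<lambda>w. w $ k) differentiable (at z)"
    using bounded_linear_imp_has_derivative[OF bounded_linear_vec_nth] unfolding differentiable_def by blast
  have nz: "complex_of_real (N z) \<noteq> 0" "complex_of_real (M z) \<noteq> 0"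
    using N_pos[OF zb] M_pos[OF zb] by auto
  have "(\<lambda>w. cnj (F w $ i) * DF i k w) differentiable (at z)"
    "(\<lambda>w. F w $ i * DF i k w) differentiable (at z)" for i
    by (intro differentiable_mult differentiable_cnj_iff[THEN iffD2] F_diff DF_diff)+
  moreover have "(\<lambda>w. F w $ i * F w $ i) differentiable (at z)" for i
    by (rule differentiable_mult[OF F_diff F_diff])
  then have "(\<lambda>w. cnj (FF w)) differentiable (at z)"
    unfolding FF_def differentiable_cnj_iff power2_eq_square
    by (intro differentiable_sum) auto
  ultimately have "XN k differentiable (at z)"
    unfolding XN_def
    by (intro differentiable_add differentiable_minus differentiable_divide differentiable_mult
        differentiable_sum differentiable_const) auto
  then have "(\<lambda>w. cnj (- ?m * XN k w / of_real (N w))) differentiable (at z)"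
    unfolding differentiable_cnj_iff
    by (intro differentiable_divide differentiable_mult differentiable_const N_diff nz)
  then obtain L1 where "((\<lambda>w. cnj (- ?m * XN k w / of_real (N w))) has_derivative L1) (at z)"
    unfolding differentiable_def by blast
  from has_derivative_transform_within_open[OF this open_U z, of e1]
  have e1: "e1 differentiable (at z)" unfolding differentiable_def e1_def
    by (metis wdbar_ln_K_IV)
  have "(\<lambda>w. cnj (?n * cnj (w $ k) / of_real (M w))) differentiable (at z)"
    unfolding differentiable_cnj_iff
    by (intro derivative_intros differentiable_cnj_iff[THEN iffD2] nth_diff M_diff nz)
  then obtain L2 where "((\<lambda>w. cnj (?n * cnj (w $ k) / of_real (M w))) has_derivative L2) (at z)"
    unfolding differentiable_def by blast
  from has_derivative_transform_within_open[OF this _ zb, of e2]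
  have e2: "e2 differentiable (at z)" unfolding differentiable_def e2_def
    by (metis wdbar_ln_K_ball open_ball unit_ball_eq_ball)
  have lev: "wd j e1 z = lam * wd j e2 z" for j
    using isometry zb unfolding holo_isometry_def levi_def e1_def e2_def by blast
  define d where "d j = cnj (wdbar j e1 z - lam * wdbar j e2 z) * (- 1 / ?m)" for j
  have "((\<lambda>w. (- 1 / ?m) * cnj (e1 w - lam * e2 w)) has_derivative
     (\<lambda>v. (- 1 / ?m) * cnj ((\<Sum>j\<in>UNIV. wd j e1 z * v $ j + wdbar j e1 z * cnj (v $ j))
        - lam * (\<Sum>j\<in>UNIV. wd j e2 z * v $ j + wdbar j e2 z * cnj (v $ j))))) (at z)"
    by (intro derivative_intros has_derivative_wirtinger e1 e2)
  also have "(\<lambda>v. (- 1 / ?m) * cnj ((\<Sum>j\<in>UNIV. wd j e1 z * v $ j + wdbar j e1 z * cnj (v $ j))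
        - lam * (\<Sum>j\<in>UNIV. wd j e2 z * v $ j + wdbar j e2 z * cnj (v $ j))))
     = (\<lambda>v. \<Sum>j\<in>UNIV. d j * v $ j)"
  proof
    fix v :: "complex^'n"
    have "(\<Sum>j\<in>UNIV. wd j e1 z * v $ j + wdbar j e1 z * cnj (v $ j))
        - lam * (\<Sum>j\<in>UNIV. wd j e2 z * v $ j + wdbar j e2 z * cnj (v $ j))
        = (\<Sum>j\<in>UNIV. (wdbar j e1 z - lam * wdbar j e2 z) * cnj (v $ j))"
      by (simp add: lev sum_distrib_left algebra_simps flip: sum_subtractf)
    then show "(- 1 / ?m) * cnj ((\<Sum>j\<in>UNIV. wd j e1 z * v $ j + wdbar j e1 z * cnj (v $ j))
        - lam * (\<Sum>j\<in>UNIV. wd j e2 z * v $ j + wdbar j e2 z * cnj (v $ j))) = (\<Sum>j\<in>UNIV. d j * v $ j)"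
      by (simp add: d_def sum_distrib_left sum_divide_distrib sum_negf algebra_simps)
  qed
  finally have "((\<lambda>w. (- 1 / ?m) * cnj (e1 w - lam * e2 w)) has_derivative (\<lambda>v. \<Sum>j\<in>UNIV. d j * v $ j)) (at z)" .
  moreover have "(- 1 / ?m) * cnj (e1 w - lam * e2 w) = chi k w" if "w \<in> U" for w
  proof -
    have e1w: "e1 w = cnj (- ?m * XN k w / of_real (N w))" unfolding e1_def using that by (rule wdbar_ln_K_IV)
    have e2w: "e2 w = cnj (?n * cnj (w $ k) / of_real (M w))" unfolding e2_def
      using that by (intro wdbar_ln_K_ball) (simp add: U_def)
    have "complex_of_real (M w) \<noteq> 0" "complex_of_real (N w) \<noteq> 0" "?m \<noteq> 0"
      using M_pos[of w] N_pos[of w] that by (auto simp: U_def)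
    then show ?thesis unfolding e1w e2w by (simp add: chi_def mu_def divide_simps) (simp add: algebra_simps)?
  qed
  ultimately show ?thesis using has_derivative_transform_within_open[OF _ open_U z] by blast
qed

text \<open>After polarization on the complex line through 0 and \<open>z0\<close>, every term of the formula for
  \<open>chi * N * M\<close> carries a conjugated factor that vanishes at 0, so the conjugate variable can be set
  to 0.\<close>
lemma chi_zero:
  assumes z0: "z0 \<in> U"
  shows "chi k z0 = 0"
proof -
  \<comment> \<open>\<open>S2\<close> is where the line stays in the ball. The disc
    \<open>S1\<close> around 1 is smaller, so that the derivative formulas on \<open>U\<close> are
    valid there.\<close>
  define S2 where "S2 = {y. 0 + y *s z0 \<in> unit_ball}"
  have "open ((\<lambda>x. 0 + x *s z0) -` U)"
    by (intro open_vimage open_U continuous_scalar_line)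
  moreover have "1 \<in> (\<lambda>x. 0 + x *s z0) -` U" using z0 by simp
  ultimately obtain r where r: "r > 0" "ball 1 r \<subseteq> (\<lambda>x. 0 + x *s z0) -` U"
    by (meson openE)
  define S1 where "S1 = ball (1::complex) r"
  have S1: "x *s z0 \<in> U" if "x \<in> S1" for x using r that by (auto simp: S1_def)
  have S12: "x \<in> S2" if "x \<in> S1" for x using S1[OF that] by (simp add: S2_def U_def)
  have S2_cnj: "cnj y \<in> S2 \<longleftrightarrow> y \<in> S2" for y
    by (simp add: S2_def unit_ball_eq_ball norm_vector_scalar_mult)
  define f where "f i x = F (x *s z0) $ i" for i x
  define g where "g x = FF (x *s z0)" for x
  define d where "d i x = DF i k (x *s z0)" for i x
  define ch where "ch x = chi k (x *s z0)" for x
  \<comment> \<open>The reflections \<open>f'\<close> and \<open>g'\<close> are holomorphic in y and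
    equal the conjugates of \<open>f\<close> and \<open>g\<close> at x when y = cnj x.\<close>
  define f' where "f' i y = cnj (f i (cnj y))" for i y
  define g' where "g' y = cnj (g (cnj y))" for y
  define q where "q = complex_of_real (\<Sum>j\<in>UNIV. (cmod (z0 $ j))\<^sup>2)"
  define NN where "NN x y = 1 - (\<Sum>i\<in>UNIV. f i x * f' i y) + g x * g' y / 4" for x y
  define MM where "MM x y = 1 - x * y * q" for x y
  define TT where "TT x y = - (\<Sum>i\<in>UNIV. f' i y * d i x) + g' y * (\<Sum>i\<in>UNIV. f i x * d i x) / 2" for x y
  \<comment> \<open>The definition of \<open>chi\<close> with denominators cleared and conjugates
    replaced by reflections; it vanishes for y = cnj x.\<close>
  define K where "K x y = ch x * NN x y * MM x y
      - (TT x y * MM x y + of_real mu * (y * cnj (z0 $ k)) * NN x y)" for x y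
  have holf: "f i holomorphic_on S2" for i
    unfolding S2_def f_def using F_line_holomorphic[of 0 z0 i] by simp
  have holg: "g holomorphic_on S2"
    unfolding g_def FF_def using holf unfolding f_def by (intro holomorphic_intros) auto
  have hold: "d i holomorphic_on S1" for i
  proof (rule holomorphic_onI)
    fix x assume x: "x \<in> S1"
    obtain e where "(DF i k has_derivative (\<lambda>v. \<Sum>j\<in>UNIV. e j * v $ j)) (at (0 + x *s z0))"
      using DF_has_derivative[OF S1[OF x]] by auto
    from has_field_derivative_line[OF this, of "\<Sum>j\<in>UNIV. e j * z0 $ j"]
    have "(d i has_field_derivative (\<Sum>j\<in>UNIV. e j * z0 $ j)) (at x)"
      by (simp add: d_def[abs_def] sum_distrib_left algebra_simps)
    then show "d i field_differentiable (at x within S1)"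
      using field_differentiable_at_within field_differentiable_def by blast
  qed
  have holc: "ch holomorphic_on S1"
  proof (rule holomorphic_onI)
    fix x assume x: "x \<in> S1"
    obtain e where "(chi k has_derivative (\<lambda>v. \<Sum>j\<in>UNIV. e j * v $ j)) (at (0 + x *s z0))"
      using chi_has_derivative[OF S1[OF x]] by auto
    from has_field_derivative_line[OF this, of "\<Sum>j\<in>UNIV. e j * z0 $ j"]
    have "(ch has_field_derivative (\<Sum>j\<in>UNIV. e j * z0 $ j)) (at x)"
      by (simp add: ch_def[abs_def] sum_distrib_left algebra_simps)
    then show "ch field_differentiable (at x within S1)"
      using field_differentiable_at_within field_differentiable_def by blast
  qed
  have oS2: "open S2" "connected S2" unfolding S2_def by (rule line_in_unit_ball)+
  have cnjS2: "cnj ` S2 = S2" using S2_cnj by (metis (no_types, lifting) complex_cnj_cnj image_iff subsetI subset_antisym image_subset_iff)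
  have holf': "f' i holomorphic_on S2" for i
    using holomorphic_on_compose_cnj_cnj[of "f i" S2] holf oS2 cnjS2 by (simp add: f'_def[abs_def] o_def)
  have holg': "g' holomorphic_on S2"
    using holomorphic_on_compose_cnj_cnj[of g S2] holg oS2 cnjS2 by (simp add: g'_def[abs_def] o_def)
  have "K 1 0 = 0"
  proof (rule polarization[of S1 S2 K r 1 1 0])
    fix a b e l
    let ?S = "{t. a + b * t \<in> S1 \<and> e + l * t \<in> S2}"
    have sub: "?S \<subseteq> {t. a + b * t \<in> S2}" using S12 by auto
    have 1: "(\<lambda>t. f i (a + b * t)) holomorphic_on ?S" "(\<lambda>t. g (a + b * t)) holomorphic_on ?S" for i
      by (rule holomorphic_on_subset[OF _ sub], use holomorphic_affine_compose[OF holf, where a=a and b=b and Q="\<lambda>_. True"]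
          holomorphic_affine_compose[OF holg, where a=a and b=b and Q="\<lambda>_. True"] in simp)+
    have 2: "(\<lambda>t. d i (a + b * t)) holomorphic_on ?S" "(\<lambda>t. ch (a + b * t)) holomorphic_on ?S" for i
      by (rule holomorphic_affine_compose[OF hold] holomorphic_affine_compose[OF holc])+
    have 3: "(\<lambda>t. f' i (e + l * t)) holomorphic_on ?S" "(\<lambda>t. g' (e + l * t)) holomorphic_on ?S" for i
      using holomorphic_affine_compose[OF holf', where a=e and b=l and Q="\<lambda>t. a + b * t \<in> S1"] holomorphic_affine_compose[OF holg', where a=e and b=l and Q="\<lambda>t. a + b * t \<in> S1"]
      by (simp_all add: conj_commute)
    show "(\<lambda>t. K (a + b * t) (e + l * t)) holomorphic_on ?S"
      unfolding K_def NN_def MM_def TT_def by (intro holomorphic_intros 1 2 3) auto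
  next
    fix x :: complex assume "x \<in> ball 1 r"
    then have x: "x \<in> S1" by (simp add: S1_def)
    let ?z = "x *s z0"
    have zb: "?z \<in> unit_ball" using S1[OF x] by (simp add: U_def)
    have "NN x (cnj x) = of_real (N ?z)"
      by (simp add: NN_def N_def f_def f'_def g_def g'_def of_real_cmod_power2)
    moreover have "MM x (cnj x) = of_real (M ?z)"
      by (simp add: MM_def M_def q_def norm_mult power_mult_distrib of_real_cmod_power2 sum_distrib_left algebra_simps)
    moreover have "TT x (cnj x) = XN k ?z"
      by (simp add: TT_def XN_def f_def f'_def g_def g'_def d_def)
    moreover have "of_real (N ?z) \<noteq> (0::complex)" "of_real (M ?z) \<noteq> (0::complex)"
      using N_pos[OF zb] M_pos[OF zb] by auto
    ultimately show "K x (cnj x) = 0"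
      by (simp add: K_def ch_def chi_def field_simps)
  qed (use oS2 r S12 S2_cnj in \<open>auto simp: S1_def[symmetric]\<close>, auto simp: S1_def S2_def unit_ball_eq_ball)
  moreover have "NN 1 0 = 1" "TT 1 0 = 0" by (simp_all add: NN_def TT_def f'_def g'_def f_def g_def F0 FF_0)
  ultimately show ?thesis by (simp add: K_def MM_def ch_def)
qed

section \<open>Integration of the log ratio\<close>

lemma N_0: "N 0 = 1" and M_0: "M 0 = 1"
  by (simp_all add: N_def M_def F0 FF_0)

lemma log_ratio_has_derivative:
  assumes x: "x \<in> U"
  shows "((\<lambda>z. ln (N z) - mu * ln (M z)) has_derivative (\<lambda>v. 2 * Re (\<Sum>k\<in>UNIV. chi k x * v $ k))) (at x)"
proof -
  have xb: "x \<in> unit_ball" using x by (simp add: U_def)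
  have "((\<lambda>z. (0 + 1 * ln (N z)) - (0 + mu * ln (M z))) has_derivative
      (\<lambda>v. 2 * Re (\<Sum>k\<in>UNIV. (of_real 1 * XN k x / of_real (N x)) * v $ k)
         - 2 * Re (\<Sum>k\<in>UNIV. (of_real mu * - cnj (x $ k) / of_real (M x)) * v $ k))) (at x)"
    by (intro has_derivative_diff ln_has_derivative N_has_derivative N_pos M_has_derivative M_pos x xb)
  moreover have "(\<Sum>k\<in>UNIV. chi k x * v $ k) = (\<Sum>k\<in>UNIV. (of_real 1 * XN k x / of_real (N x)) * v $ k)
         - (\<Sum>k\<in>UNIV. (of_real mu * - cnj (x $ k) / of_real (M x)) * v $ k)" for v
    unfolding sum_subtractf[symmetric] by (simp add: chi_def algebra_simps)
  ultimately show ?thesis by (simp del: Re_sum add: right_diff_distrib)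
qed

text \<open>A segment from a point of \<open>U\<close> meets the zeros of \<open>R\<close> at
  finitely many parameters only, and continuity bridges these. So the log ratio is constant, and it
  is 0 at the origin.\<close>

lemma N_eq_M_powr:
  assumes z: "z \<in> unit_ball"
  shows "N z = M z powr mu"
proof -
  define \<phi> where "\<phi> z = ln (N z) - mu * ln (M z)" for z
  have cont: "continuous_on unit_ball \<phi>"
    unfolding \<phi>_def using N_pos M_pos by (intro continuous_intros continuous_N continuous_M) force+
  obtain z1 where z1: "z1 \<in> U"
    using mpoly_nonzero_in_ball[OF R_nonzero, of 1 0] by (auto simp: U_def unit_ball_eq_ball)
  then have z1b: "z1 \<in> unit_ball" by (simp add: U_def)
  have const: "\<phi> w = \<phi> z1" if w: "w \<in> unit_ball" for w
  proof -
    obtain p where p: "\<And>t. mpeval R (z1 + t *s (w - z1)) = poly p t" using mpeval_line by blast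
    have "p \<noteq> 0" using p[of 0] z1 by (auto simp: U_def)
    then have fin: "finite {t::real. poly p (of_real t) = 0}"
      using finite_vimageI[OF poly_roots_finite[of p], of complex_of_real]
      by (simp add: vimage_def inj_def)
    have inb: "z1 + t *\<^sub>R (w - z1) \<in> unit_ball" if "t \<in> {0..1}" for t
    proof -
      have "z1 + t *\<^sub>R (w - z1) = (1 - t) *\<^sub>R z1 + t *\<^sub>R w" by (simp add: algebra_simps)
      then show ?thesis using convexD[OF convex_ball, of z1 0 1 w "1 - t" t] z1b w that
        by (simp add: unit_ball_eq_ball)
    qed
    have "\<phi> (z1 + 1 *\<^sub>R (w - z1)) = \<phi> z1"
    proof (rule has_derivative_zero_unique_strong_interval[OF fin, of 0 1 "\<lambda>t. \<phi> (z1 + t *\<^sub>R (w - z1))"])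
      show "continuous_on {0..1} (\<lambda>t. \<phi> (z1 + t *\<^sub>R (w - z1)))"
        using inb by (intro continuous_on_compose2[OF cont] continuous_intros) auto
      fix t assume t: "t \<in> {0..1} - {t. poly p (of_real t) = 0}"
      let ?x = "z1 + t *\<^sub>R (w - z1)"
      have "?x = z1 + of_real t *s (w - z1)" by (simp add: vec_eq_iff scaleR_conv_of_real[where 'a=complex] algebra_simps)
      then have "mpeval R ?x \<noteq> 0" using p t by simp
      then have x: "?x \<in> U" using inb t by (simp add: U_def)
      have "(\<phi> has_derivative (\<lambda>v. 2 * Re (\<Sum>k\<in>UNIV. chi k ?x * v $ k))) (at ?x)"
        using log_ratio_has_derivative[OF x] by (simp add: \<phi>_def[abs_def])
      then have D: "(\<phi> has_derivative (\<lambda>v. 0)) (at ?x)" by (simp add: chi_zero[OF x])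
      have "((\<lambda>t. z1 + t *\<^sub>R (w - z1)) has_derivative (\<lambda>h. h *\<^sub>R (w - z1))) (at t within {0..1})"
        by (auto intro!: derivative_eq_intros)
      from has_derivative_compose[OF this D]
      show "((\<lambda>t. \<phi> (z1 + t *\<^sub>R (w - z1))) has_derivative (\<lambda>h. 0)) (at t within {0..1})" .
    qed auto
    then show ?thesis by simp
  qed
  have "\<phi> z = \<phi> 0" using const[OF z] const[of 0] by (simp add: unit_ball_eq_ball)
  then have "ln (N z) = mu * ln (M z)" by (simp add: \<phi>_def N_0 M_0)
  then show ?thesis using exp_ln[OF N_pos[OF z]] M_pos[OF z] by (simp add: powr_def)
qed

section \<open>The isometric constant\<close>

text \<open>Along a real ray M is 1 - r^2 and N is a rational function of r, so orders at r = 1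
  decide.\<close>

lemma mu_nat: "\<exists>k::nat. mu = real k"
proof -
  obtain j :: 'n where True by simp
  have "mvar j \<noteq> 0"
    using mpeval_var[of j "1"] by (metis mpeval_0 one_index zero_neq_one)
  \<comment> \<open>The coordinate factor ensures that \<open>z1\<close> is nonzero as well as
    \<open>mpeval R z1\<close>, so the ray can be normalized.\<close>
  then have "R * mvar j \<noteq> 0" using R_nonzero mpoly_mult_eq_0 by blast
  then obtain z1 where z1: "mpeval (R * mvar j) z1 \<noteq> 0" using mpoly_nonzero_somewhere by blast
  then have z1': "mpeval R z1 \<noteq> 0" "z1 \<noteq> 0" by auto
  define v where "v = complex_of_real (inverse (norm z1)) *s z1"
  have nv: "norm v = 1" using z1' by (simp add: v_def norm_vector_scalar_mult norm_inverse)
  have z1v: "complex_of_real (norm z1) *s v = z1" using z1' by (simp add: v_def vec_eq_iff)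
  obtain pR where pR: "\<And>t. mpeval R (0 + t *s v) = poly pR t" using mpeval_line by blast
  have "\<forall>i. \<exists>p. \<forall>t. mpeval (P $ i) (0 + t *s v) = poly p t" using mpeval_line by blast
  from choice[OF this] obtain p where p: "\<And>i t. mpeval (P $ i) (0 + t *s v) = poly (p i) t" by blast
  obtain qR where qR: "\<And>r. (cmod (poly pR (of_real r)))\<^sup>2 = poly qR r"
    using cmod_power2_poly_of_real by blast
  have "\<forall>i. \<exists>q. \<forall>r. (cmod (poly (p i) (of_real r)))\<^sup>2 = poly q r"
    using cmod_power2_poly_of_real by blast
  from choice[OF this] obtain q where q: "\<And>i r. (cmod (poly (p i) (of_real r)))\<^sup>2 = poly (q i) r" by blast
  obtain s where s: "\<And>r. (cmod (poly (\<Sum>i\<in>UNIV. (p i)\<^sup>2) (of_real r)))\<^sup>2 = poly s r"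
    using cmod_power2_poly_of_real by blast
  have "poly pR (of_real (norm z1)) \<noteq> 0" using pR[of "of_real (norm z1)"] z1v z1' by simp
  then have "poly qR (norm z1) \<noteq> 0" using qR[of "norm z1"] by (metis norm_eq_zero power_eq_0_iff)
  then have qR0: "qR \<noteq> 0" by auto
  \<comment> \<open>\<open>qR\<close> is the squared modulus of \<open>R\<close> on the ray; its
    square clears the denominators of all terms of N.\<close>
  show ?thesis
  proof (rule powr_rational_imp_nat[of "qR\<^sup>2" mu "qR\<^sup>2 - qR * (\<Sum>i\<in>UNIV. q i) + smult (1/4) s"])
    show "qR\<^sup>2 \<noteq> 0" using qR0 by simp
    show "mu > 0" by (rule mu_pos)
    fix r :: real assume r: "r \<in> {0<..<1}" and "poly (qR\<^sup>2) r \<noteq> 0"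
    then have nz: "poly qR r \<noteq> 0" by simp
    let ?z = "complex_of_real r *s v"
    have R0: "poly pR (of_real r) \<noteq> 0" using nz qR[of r] by auto
    have zb: "?z \<in> unit_ball" using r nv by (simp add: unit_ball_eq_ball norm_vector_scalar_mult)
    have zU: "?z \<in> U" using zb R0 pR[of "of_real r"] by (simp add: U_def)
    have Fz: "F ?z $ i = poly (p i) (of_real r) / poly pR (of_real r)" for i
      using F_rational[OF zU] p pR by simp
    have a: "(cmod (F ?z $ i))\<^sup>2 = poly (q i) r / poly qR r" for i
      by (simp add: Fz norm_divide power_divide q qR)
    have "FF ?z = poly (\<Sum>i\<in>UNIV. (p i)\<^sup>2) (of_real r) / (poly pR (of_real r))\<^sup>2"
      by (simp add: FF_def Fz power_divide poly_sum sum_divide_distrib)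
    then have "(cmod (FF ?z))\<^sup>2 = poly s r / ((cmod (poly pR (of_real r)))\<^sup>2)\<^sup>2"
      by (simp add: norm_divide power_divide s norm_power)
    then have b: "(cmod (FF ?z))\<^sup>2 = poly s r / (poly qR r)\<^sup>2" by (simp add: qR)
    have "norm v ^ 2 = (\<Sum>j\<in>UNIV. (cmod (v $ j))\<^sup>2)"
      by (simp add: norm_vec_def L2_set_def sum_nonneg)
    then have "M ?z = 1 - r\<^sup>2"
      using nv by (simp add: M_def norm_mult power_mult_distrib flip: sum_distrib_left)
    then have "(1 - r\<^sup>2) powr mu = N ?z" using N_eq_M_powr[OF zb] by simp
    also have "\<dots> = 1 - (\<Sum>i\<in>UNIV. poly (q i) r) / poly qR r + poly s r / (poly qR r)\<^sup>2 / 4"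
      by (simp add: N_def a b sum_divide_distrib)
    finally have pm: "(1 - r\<^sup>2) powr mu = 1 - (\<Sum>i\<in>UNIV. poly (q i) r) / poly qR r + poly s r / (poly qR r)\<^sup>2 / 4" .
    show "poly (qR\<^sup>2 - qR * (\<Sum>i\<in>UNIV. q i) + smult (1/4) s) r = poly (qR\<^sup>2) r * (1 - r\<^sup>2) powr mu"
      unfolding pm using nz by (simp add: poly_sum field_simps power2_eq_square)
  qed
qed

lemma mu_eq_1:
  assumes card: "CARD('n) \<ge> 2"
  shows "mu = 1"
proof -
  obtain k :: nat where k: "mu = real k" using mu_nat by blast
  have "k \<noteq> 0" using k mu_pos by auto
  moreover have False if k2: "k \<ge> 2"
  proof -
    have "(0::complex^'n) \<in> unit_ball" by (simp add: unit_ball_eq_ball)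
    then obtain L where L: "(F has_derivative L) (at 0)" "\<And>c v. L (c *s v) = c *s L v"
      using F_has_derivative by blast
    have "bounded_linear L" using L(1) by (rule has_derivative_bounded_linear)
    \<comment> \<open>\<open>L v\<close> is the linear Taylor coefficient of F along v, so its
      isotropy makes F\<cdot>F vanish to order at least three there.\<close>
    then obtain v where v: "norm v = 1" "(\<Sum>i\<in>UNIV. (L v $ i)\<^sup>2) = 0"
      using complex_quadratic_form_isotropic[OF card, of L] L(2) by (auto simp: linear_simps)
    define S where "S = ball (0::complex) 1"
    have Sb: "x *s v \<in> unit_ball \<longleftrightarrow> x \<in> S" for x
      by (simp add: S_def unit_ball_eq_ball norm_vector_scalar_mult v)
    have cnjS: "cnj ` S = S" unfolding S_def by (auto simp: image_iff intro!: bexI[where x="cnj _"])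
    define f where "f i x = F (x *s v) $ i" for i x
    define f' where "f' i y = cnj (f i (cnj y))" for i y
    define g where "g x = (\<Sum>i\<in>UNIV. (f i x)\<^sup>2)" for x
    define g' where "g' y = (\<Sum>i\<in>UNIV. (f' i y)\<^sup>2)" for y
    have holf: "f i holomorphic_on S" for i
      using F_line_holomorphic[of 0 v i] by (simp add: Sb f_def[abs_def])
    have holf': "f' i holomorphic_on S" for i
      using holomorphic_on_compose_cnj_cnj[of "f i" S] holf cnjS by (simp add: f'_def[abs_def] o_def S_def)
    define K where "K x y = 1 - (\<Sum>i\<in>UNIV. f i x * f' i y) + g x * g' y / 4 - (1 - x * y) ^ k" for x y
    have K0: "K x y = 0" if "x \<in> S" "y \<in> S" for x y
    proof (rule polarization[of S S K 1 0 x y])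
      fix a b e l
      let ?S = "{t. a + b * t \<in> S \<and> e + l * t \<in> S}"
      have 1: "(\<lambda>t. f i (a + b * t)) holomorphic_on ?S" for i
        by (rule holomorphic_affine_compose[OF holf])
      have 2: "(\<lambda>t. f' i (e + l * t)) holomorphic_on ?S" for i
        using holomorphic_affine_compose[OF holf', where a=e and b=l and Q="\<lambda>t. a + b * t \<in> S"]
        by (simp add: conj_commute)
      show "(\<lambda>t. K (a + b * t) (e + l * t)) holomorphic_on ?S"
        unfolding K_def g_def g'_def by (intro holomorphic_intros 1 2) auto
    next
      fix x :: complex assume "x \<in> ball 0 1"
      then have x: "x *s v \<in> unit_ball" by (simp add: Sb S_def)
      have "norm v ^ 2 = (\<Sum>j\<in>UNIV. (cmod (v $ j))\<^sup>2)"
        by (simp add: norm_vec_def L2_set_def sum_nonneg)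
      then have Mx: "M (x *s v) = 1 - (cmod x)\<^sup>2"
        using v by (simp add: M_def norm_mult power_mult_distrib flip: sum_distrib_left)
      have "N (x *s v) = M (x *s v) ^ k"
        using N_eq_M_powr[OF x] M_pos[OF x] by (simp add: k powr_realpow)
      then have "complex_of_real (N (x *s v)) = of_real (M (x *s v)) ^ k" by simp
      moreover have "complex_of_real (N (x *s v)) = 1 - (\<Sum>i\<in>UNIV. f i x * f' i (cnj x)) + g x * g' (cnj x) / 4"
        by (simp add: N_def FF_def f_def f'_def g_def g'_def of_real_cmod_power2)
      moreover have "complex_of_real (M (x *s v)) = 1 - x * cnj x" by (simp add: Mx of_real_cmod_power2)
      ultimately show "K x (cnj x) = 0" by (simp add: K_def)
    qed (use that in \<open>auto simp: S_def\<close>)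
    have f0: "f i 0 = 0" for i by (simp add: f_def F0)
    define f1 where "f1 i = deriv (f i)" for i
    define f2 where "f2 i = deriv (f1 i) 0" for i
    have d1: "(f i has_field_derivative f1 i x) (at x)" if "x \<in> S" for i x
      unfolding f1_def using holf that by (intro holomorphic_derivI[of _ S]) (auto simp: S_def)
    have d2: "(f1 i has_field_derivative f2 i) (at 0)" for i
      unfolding f2_def using holomorphic_deriv[OF holf, of i]
      by (intro holomorphic_derivI[of _ S]) (auto simp: S_def f1_def)
    have "((\<lambda>x. F (0 + x *s v) $ i) has_field_derivative L v $ i) (at 0)" for i
      by (rule has_field_derivative_line) (use component_has_derivative[OF L(1)] L(2) in auto)
    then have f1L: "f1 i 0 = L v $ i" for i
      using DERIV_unique[OF d1[of 0 i]] by (simp add: S_def f_def[abs_def])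
    \<comment> \<open>The second x-derivative at 0 of the polarized identity: the F\<cdot>F term
      drops out, and the power of 1 - x y leaves -k(k-1) y^2.\<close>
    have E1: "(\<Sum>i\<in>UNIV. f2 i * f' i y) = - of_nat (k * (k - 1)) * y\<^sup>2" if y: "y \<in> S" for y
    proof (rule second_derivatives_unique[of S 0 "\<lambda>x. \<Sum>i\<in>UNIV. f i x * f' i y"
          "\<lambda>x. 1 + g x * g' y / 4 - (1 - x * y) ^ k" "\<lambda>x. \<Sum>i\<in>UNIV. f1 i x * f' i y"
          "\<lambda>x. (\<Sum>i\<in>UNIV. 2 * (f i x * f1 i x)) * g' y / 4 + of_nat k * y * (1 - x * y) ^ (k - 1)"])
      show "open S" "0 \<in> S" by (auto simp: S_def)
      show "(\<Sum>i\<in>UNIV. f i x * f' i y) = 1 + g x * g' y / 4 - (1 - x * y) ^ k" if "x \<in> S" for x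
        using K0[OF that y] by (simp add: K_def algebra_simps)
      show "((\<lambda>x. \<Sum>i\<in>UNIV. f i x * f' i y) has_field_derivative (\<Sum>i\<in>UNIV. f1 i x * f' i y)) (at x)" if "x \<in> S" for x
        by (intro DERIV_sum DERIV_cmult_right d1 that)
      show "((\<lambda>x. 1 + g x * g' y / 4 - (1 - x * y) ^ k) has_field_derivative
          (\<Sum>i\<in>UNIV. 2 * (f i x * f1 i x)) * g' y / 4 + of_nat k * y * (1 - x * y) ^ (k - 1)) (at x)" if "x \<in> S" for x
      proof -
        have gd: "(g has_field_derivative (\<Sum>i\<in>UNIV. 2 * (f i x * f1 i x))) (at x)"
          unfolding g_def by (auto intro!: DERIV_sum derivative_eq_intros d1 that)
        show ?thesis by (auto intro!: derivative_eq_intros gd)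
      qed
      show "((\<lambda>x. \<Sum>i\<in>UNIV. f1 i x * f' i y) has_field_derivative (\<Sum>i\<in>UNIV. f2 i * f' i y)) (at 0)"
        by (intro DERIV_sum DERIV_cmult_right d2)
      have "((\<lambda>x. \<Sum>i\<in>UNIV. 2 * (f i x * f1 i x)) has_field_derivative (\<Sum>i\<in>UNIV. 2 * ((f1 i 0)\<^sup>2 + f i 0 * f2 i))) (at 0)"
        by (intro DERIV_sum DERIV_cmult) (auto intro!: derivative_eq_intros d1 d2 simp: S_def power2_eq_square)
      also have "(\<Sum>i\<in>UNIV. 2 * ((f1 i 0)\<^sup>2 + f i 0 * f2 i)) = 0"
        using v(2) by (simp add: f0 f1L flip: sum_distrib_left)
      finally have gd: "((\<lambda>x. \<Sum>i\<in>UNIV. 2 * (f i x * f1 i x)) has_field_derivative 0) (at 0)" .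
      show "((\<lambda>x. (\<Sum>i\<in>UNIV. 2 * (f i x * f1 i x)) * g' y / 4 + of_nat k * y * (1 - x * y) ^ (k - 1))
          has_field_derivative - of_nat (k * (k - 1)) * y\<^sup>2) (at 0)"
      proof -
        have "((\<lambda>x. of_nat k * y * (1 - x * y) ^ (k - 1)) has_field_derivative - of_nat (k * (k - 1)) * y\<^sup>2) (at 0)"
          by (auto intro!: derivative_eq_intros simp: power2_eq_square)
        from DERIV_add[OF DERIV_cdivide[OF DERIV_cmult_right[OF gd, of "g' y"], of 4] this]
        show ?thesis by simp
      qed
    qed
    have E2: "(\<Sum>i\<in>UNIV. f i x * cnj (f2 i)) = - of_nat (k * (k - 1)) * x\<^sup>2" if x: "x \<in> S" for x
    proof -
      have "cnj x \<in> S" using x by (simp add: S_def)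
      from arg_cong[OF E1[OF this], of cnj] show ?thesis by (simp add: f'_def mult.commute)
    qed
    \<comment> \<open>Conjugation has moved the free variable into \<open>f\<close>; a second
      differentiation yields the squared norm of \<open>f2\<close>, which comes out negative for k
      at least 2.\<close>
    have "(\<Sum>i\<in>UNIV. f2 i * cnj (f2 i)) = - of_nat (k * (k - 1)) * 2"
    proof (rule second_derivatives_unique[of S 0 "\<lambda>x. \<Sum>i\<in>UNIV. f i x * cnj (f2 i)"
          "\<lambda>x. - of_nat (k * (k - 1)) * x\<^sup>2" "\<lambda>x. \<Sum>i\<in>UNIV. f1 i x * cnj (f2 i)"
          "\<lambda>x. - of_nat (k * (k - 1)) * (2 * x)"])
      show "((\<lambda>x. \<Sum>i\<in>UNIV. f i x * cnj (f2 i)) has_field_derivative (\<Sum>i\<in>UNIV. f1 i x * cnj (f2 i))) (at x)" if "x \<in> S" for x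
        by (intro DERIV_sum DERIV_cmult_right d1 that)
      show "((\<lambda>x. \<Sum>i\<in>UNIV. f1 i x * cnj (f2 i)) has_field_derivative (\<Sum>i\<in>UNIV. f2 i * cnj (f2 i))) (at 0)"
        by (intro DERIV_sum DERIV_cmult_right d2)
      show "((\<lambda>x. - of_nat (k * (k - 1)) * x\<^sup>2) has_field_derivative - of_nat (k * (k - 1)) * (2 * x)) (at x)" for x :: complex
        by (rule DERIV_cmult) (auto intro!: derivative_eq_intros)
      show "((\<lambda>x. - of_nat (k * (k - 1)) * (2 * x)) has_field_derivative - of_nat (k * (k - 1)) * 2) (at (0::complex))"
        by (rule DERIV_cmult) (auto intro!: derivative_eq_intros)
    qed (use E2 in \<open>auto simp: S_def\<close>)
    then have "complex_of_real (\<Sum>i\<in>UNIV. (cmod (f2 i))\<^sup>2) = complex_of_real (- real (k * (k - 1)) * 2)"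
      by (simp add: of_real_cmod_power2)
    then have "(\<Sum>i\<in>UNIV. (cmod (f2 i))\<^sup>2) = - real (k * (k - 1)) * 2" by (simp only: of_real_eq_iff)
    moreover have "(\<Sum>i\<in>UNIV. (cmod (f2 i))\<^sup>2) \<ge> 0" by (intro sum_nonneg) auto
    moreover have "real (k * (k - 1)) > 0" using k2 by simp
    ultimately show False by linarith
  qed
  ultimately have "k = 1" by fastforce
  then show ?thesis using k by simp
qed

section \<open>The degree\<close>

text \<open>The polarization of M - N, holomorphic in z and antiholomorphic in w.\<close>

definition H :: "complex^'n \<Rightarrow> complex^'n \<Rightarrow> complex" where
  "H z w = (\<Sum>i\<in>UNIV. F z $ i * cnj (F w $ i)) - (\<Sum>j\<in>UNIV. z $ j * cnj (w $ j)) - FF z * cnj (FF w) / 4"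

text \<open>The two base points may differ while the direction is shared, which allows polarization
  to be iterated over two directions. Radius 3/2 admits both parameters 0 and 1.\<close>

lemma H_polarize_line:
  fixes x y :: complex
  defines "S \<equiv> ball (0::complex) (3/2)"
  assumes a: "\<And>x. x \<in> S \<Longrightarrow> a + x *s b \<in> unit_ball" and e: "\<And>x. x \<in> S \<Longrightarrow> e + x *s b \<in> unit_ball"
    and zero: "\<And>x. x \<in> S \<Longrightarrow> H (a + x *s b) (e + x *s b) = 0"
    and xy: "x \<in> S" "y \<in> S"
  shows "H (a + x *s b) (e + y *s b) = 0"
proof -
  define f where "f i x = F (a + x *s b) $ i" for i x
  define h where "h i x = F (e + x *s b) $ i" for i x
  define f' where "f' i y = cnj (h i (cnj y))" for i y
  have cnjS: "cnj ` S = S" unfolding S_def by (auto simp: image_iff intro!: bexI[where x="cnj _"])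
  have holf: "f i holomorphic_on S" for i
    unfolding f_def by (rule holomorphic_on_subset[OF F_line_holomorphic]) (use a in auto)
  have "h i holomorphic_on S" for i
    unfolding h_def by (rule holomorphic_on_subset[OF F_line_holomorphic]) (use e in auto)
  then have holf': "f' i holomorphic_on S" for i
    using holomorphic_on_compose_cnj_cnj[of "h i" S] cnjS by (simp add: f'_def[abs_def] o_def S_def)
  define K where "K x y = (\<Sum>i\<in>UNIV. f i x * f' i y) - (\<Sum>j\<in>UNIV. (a $ j + x * b $ j) * (cnj (e $ j) + y * cnj (b $ j)))
     - (\<Sum>i\<in>UNIV. (f i x)\<^sup>2) * (\<Sum>i\<in>UNIV. (f' i y)\<^sup>2) / 4" for x y
  have K: "K x (cnj y) = H (a + x *s b) (e + y *s b)" for x y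
    by (simp add: K_def H_def FF_def f_def f'_def h_def)
  have "K x (cnj y) = 0"
  proof (rule polarization[of S S K "3/2" 0])
    fix p q r s
    let ?S = "{t. p + q * t \<in> S \<and> r + s * t \<in> S}"
    have 1: "(\<lambda>t. f i (p + q * t)) holomorphic_on ?S" for i
      by (rule holomorphic_affine_compose[OF holf])
    have 2: "(\<lambda>t. f' i (r + s * t)) holomorphic_on ?S" for i
      using holomorphic_affine_compose[OF holf', where a=r and b=s and Q="\<lambda>t. p + q * t \<in> S"]
      by (simp add: conj_commute)
    show "(\<lambda>t. K (p + q * t) (r + s * t)) holomorphic_on ?S"
      unfolding K_def by (intro holomorphic_intros 1 2) auto
  qed (use xy zero K in \<open>auto simp: S_def\<close>)
  then show ?thesis by (simp add: K)
qed

text \<open>Cross-multiplication makes \<open>R\<close> a divisor of every component of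
  \<open>P\<close>. Lowest terms force it to be constant, so the local formula holds on the whole
  ball.\<close>

lemma linear_case:
  fixes A :: "complex^'n^'m"
  assumes r: "r > 0" "r \<le> 1" and lin: "\<And>z. z \<in> ball 0 r \<Longrightarrow> F z = A *v z"
  shows "rdeg P R \<le> 2 \<and> (\<forall>z\<in>unit_ball. F z = A *v z)"
proof -
  define lf where "lf i = linear_form (\<lambda>j. A $ i $ j)" for i
  have ev: "mpeval (lf i) z = (A *v z) $ i" for i z
    by (simp add: lf_def matrix_vector_mult_def)
  have P: "P $ i = R * lf i" for i
  proof -
    have "R * (P $ i - R * lf i) = 0"
    proof (rule mpoly_eqI_ball[OF r(1), of 0])
      fix z :: "complex^'n" assume z: "z \<in> ball 0 r"
      show "mpeval (R * (P $ i - R * lf i)) z = mpeval 0 z"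
      proof (cases "mpeval R z = 0")
        case False
        then have "z \<in> U" using z r by (simp add: U_def unit_ball_eq_ball)
        from F_rational[OF this, of i] lin[OF z] False show ?thesis
          by (simp add: ev field_simps)
      qed simp
    qed
    then show ?thesis using mpoly_mult_eq_0 R_nonzero by fastforce
  qed
  have "R dvd 1"
    using rational P unfolding rational_rep_def lowest_terms_rep_def by (metis dvd_refl dvd_triv_left)
  then obtain s where s: "s \<noteq> 0" "R = mconst s" using mpoly_unit_const by blast
  have "mdeg (P $ i) \<le> 0 + 1" for i
    unfolding P lf_def by (intro mdeg_mult mdeg_linear_form) (simp add: s)
  then have "mdeg (P $ i) \<le> 2" for i by (rule order_trans) simp
  then have "rdeg P R \<le> 2" by (simp add: rdeg_le_iff s)
  moreover have "F z = A *v z" if "z \<in> unit_ball" for z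
  proof -
    have Rz: "mpeval R z \<noteq> 0" using s by simp
    then have "z \<in> U" using that by (simp add: U_def)
    from F_rational[OF this] Rz show ?thesis by (simp add: vec_eq_iff P ev)
  qed
  ultimately show ?thesis by blast
qed

section \<open>Structure of F near 0 when \<open>mu\<close> is 1\<close>

context
  assumes card: "CARD('n) \<ge> 2"
begin

lemma H_diag: "z \<in> unit_ball \<Longrightarrow> H z z = 0"
proof -
  assume z: "z \<in> unit_ball"
  have "N z = M z" using N_eq_M_powr[OF z] M_pos[OF z] by (simp add: mu_eq_1[OF card])
  then have "complex_of_real (N z) = of_real (M z)" by simp
  then have "1 - (\<Sum>i\<in>UNIV. F z $ i * cnj (F z $ i)) + FF z * cnj (FF z) / 4 = 1 - (\<Sum>j\<in>UNIV. z $ j * cnj (z $ j))"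
    by (simp add: N_def M_def of_real_cmod_power2)
  moreover have "x - y - w = 0" if "1 - x + w = 1 - y" for x y w :: complex
    using that by algebra
  ultimately show ?thesis unfolding H_def by blast
qed

text \<open>Two one-variable polarizations suffice: the first along z over the diagonal points t w,
  the second along w. The bound 1/3 keeps s z + t w in the ball for s and t of modulus below
  3/2.\<close>

lemma H_zero:
  assumes "norm z < 1/3" "norm w < 1/3"
  shows "H z w = 0"
proof -
  let ?S = "ball (0::complex) (3/2)"
  have inb: "s *s z + t *s w \<in> unit_ball" if "s \<in> ?S" "t \<in> ?S" for s t
  proof -
    have "norm (s *s z + t *s w) \<le> cmod s * norm z + cmod t * norm w"
      using norm_triangle_ineq[of "s *s z" "t *s w"] by (simp add: norm_vector_scalar_mult)
    also have "cmod s * norm z \<le> 3/2 * norm z" using that by (intro mult_right_mono) auto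
    also have "cmod t * norm w \<le> 3/2 * norm w" using that by (intro mult_right_mono) auto
    finally show ?thesis using assms by (simp add: unit_ball_eq_ball)
  qed
  have 1: "H (t *s w + 1 *s z) (t *s w + 0 *s z) = 0" if "t \<in> ?S" for t
    by (rule H_polarize_line) (use inb[OF _ that] in \<open>auto simp: add.commute intro!: H_diag\<close>)
  have "H (z + 0 *s w) (0 + 1 *s w) = 0"
  proof (rule H_polarize_line)
    fix x assume "x \<in> ?S"
    from inb[of 1 x, OF _ this] inb[of 0 x, OF _ this] 1[OF this]
    show "z + x *s w \<in> unit_ball" "0 + x *s w \<in> unit_ball" "H (z + x *s w) (0 + x *s w) = 0"
      by (simp_all add: add.commute)
  qed auto
  then show ?thesis by simp
qed

text \<open>The polarized identity makes the differential L at 0 a Hermitian isometry and G = F - L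
  orthogonal to its range, with Gram kernel g(z) cnj(g(w)). A Gram kernel of rank one confines G to
  a single line, spanned by b.\<close>

lemma F_structure:
  obtains A :: "complex^'n^'m" where "\<And>z. z \<in> ball 0 (1/3) \<Longrightarrow> F z = A *v z"
  | A :: "complex^'n^'m" and b where "(\<Sum>i\<in>UNIV. b $ i * cnj (b $ i)) = 1"
    "\<And>v. (\<Sum>i\<in>UNIV. (A *v v) $ i * cnj (b $ i)) = 0"
    "\<And>z. z \<in> ball 0 (1/3) \<Longrightarrow> F z = A *v z + (FF z / 2) *s b"
proof -
  have "(0::complex^'n) \<in> unit_ball" by (simp add: unit_ball_eq_ball)
  then obtain L where L: "(F has_derivative L) (at 0)" "\<And>c v. L (c *s v) = c *s L v"
    using F_has_derivative by blast
  have "bounded_linear L" using L(1) by (rule has_derivative_bounded_linear)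
  then have "Vector_Spaces.linear (*s) (*s) L"
    by (intro Vector_Spaces.linear_iff[THEN iffD2]) (auto simp: L(2) linear_simps intro: vec.vector_space_axioms)
  then have A: "matrix L *v v = L v" for v by (rule matrix_works)
  have Fd: "((\<lambda>t. F (t *s v) $ i) has_field_derivative L v $ i) (at 0)" for v i
    using has_field_derivative_line[of "\<lambda>z. F z $ i" "\<lambda>v. L v $ i" 0 0 v "L v $ i"]
      component_has_derivative[OF L(1)] L(2) by simp
  have FFd: "((\<lambda>t. FF (t *s v)) has_field_derivative 0) (at 0)" for v
  proof -
    have "((\<lambda>t. \<Sum>i\<in>UNIV. (F (t *s v) $ i)\<^sup>2) has_field_derivative (\<Sum>i\<in>UNIV. 2 * F (0 *s v) $ i * L v $ i)) (at 0)"
      by (intro DERIV_sum) (auto intro!: derivative_eq_intros Fd)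
    then show ?thesis by (simp add: FF_def F0)
  qed
  have small: "\<exists>r>0. \<forall>t\<in>ball (0::complex) r. norm (t *s v) < 1/3" for v :: "complex^'n"
  proof (intro exI conjI ballI)
    have pos: "norm v + 1 > 0" by (simp add: add_nonneg_pos)
    then show "1/3 / (norm v + 1) > 0" by simp
    fix t :: complex assume t: "t \<in> ball 0 (1/3 / (norm v + 1))"
    have "cmod t * norm v \<le> cmod t * (norm v + 1)" by (intro mult_left_mono) auto
    also have "\<dots> < 1/3"
      using t by (simp only: mem_ball_0 pos_less_divide_eq[OF pos])
    finally show "norm (t *s v) < 1/3" by (simp add: norm_vector_scalar_mult)
  qed
  \<comment> \<open>The derivative of H(t v, z) = 0 at t = 0; \<open>FF\<close> contributes nothing
    because its derivative at 0 is zero.\<close>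
  have FL: "(\<Sum>i\<in>UNIV. cnj (F z $ i) * L v $ i) = (\<Sum>j\<in>UNIV. cnj (z $ j) * v $ j)" if z: "norm z < 1/3" for z v
  proof -
    obtain r where r: "r > 0" "\<And>t. t \<in> ball (0::complex) r \<Longrightarrow> norm (t *s v) < 1/3" using small by blast
    let ?h = "\<lambda>t. (\<Sum>i\<in>UNIV. cnj (F z $ i) * F (t *s v) $ i) - t * (\<Sum>j\<in>UNIV. cnj (z $ j) * v $ j) - cnj (FF z) * FF (t *s v) / 4"
    have h0: "?h t = 0" if "t \<in> ball 0 r" for t
      using H_zero[OF r(2)[OF that] z] by (simp add: H_def algebra_simps sum_distrib_left)
    have hd: "(?h has_field_derivative (\<Sum>i\<in>UNIV. cnj (F z $ i) * L v $ i) - 1 * (\<Sum>j\<in>UNIV. cnj (z $ j) * v $ j) - cnj (FF z) * 0 / 4) (at 0)"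
      by (intro DERIV_diff DERIV_sum DERIV_cmult DERIV_cmult_right DERIV_cdivide Fd FFd DERIV_ident)
    have "((\<lambda>t::complex. 0) has_field_derivative (\<Sum>i\<in>UNIV. cnj (F z $ i) * L v $ i) - 1 * (\<Sum>j\<in>UNIV. cnj (z $ j) * v $ j) - cnj (FF z) * 0 / 4) (at 0)"
      by (rule has_field_derivative_transform_within_open[OF hd, of "ball 0 r"]) (use r(1) h0 in auto)
    from DERIV_unique[OF this DERIV_const] show ?thesis by simp
  qed
  \<comment> \<open>Conjugating \<open>FL\<close> and differentiating in the remaining
    variable.\<close>
  have LL: "(\<Sum>i\<in>UNIV. L u $ i * cnj (L v $ i)) = (\<Sum>j\<in>UNIV. u $ j * cnj (v $ j))" for u v
  proof -
    obtain r where r: "r > 0" "\<And>t. t \<in> ball (0::complex) r \<Longrightarrow> norm (t *s u) < 1/3" using small by blast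
    let ?h = "\<lambda>t. (\<Sum>i\<in>UNIV. F (t *s u) $ i * cnj (L v $ i)) - t * (\<Sum>j\<in>UNIV. u $ j * cnj (v $ j))"
    have h0: "?h t = 0" if "t \<in> ball 0 r" for t
      using arg_cong[OF FL[OF r(2)[OF that], of v], of cnj] by (simp add: algebra_simps sum_distrib_left)
    have hd: "(?h has_field_derivative (\<Sum>i\<in>UNIV. L u $ i * cnj (L v $ i)) - 1 * (\<Sum>j\<in>UNIV. u $ j * cnj (v $ j))) (at 0)"
      by (intro DERIV_diff DERIV_sum DERIV_cmult_right Fd DERIV_ident)
    have "((\<lambda>t::complex. 0) has_field_derivative (\<Sum>i\<in>UNIV. L u $ i * cnj (L v $ i)) - 1 * (\<Sum>j\<in>UNIV. u $ j * cnj (v $ j))) (at 0)"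
      by (rule has_field_derivative_transform_within_open[OF hd, of "ball 0 r"]) (use r(1) h0 in auto)
    from DERIV_unique[OF this DERIV_const] show ?thesis by simp
  qed
  define G where "G z = F z - L z" for z
  have GL: "(\<Sum>i\<in>UNIV. G z $ i * cnj (L v $ i)) = 0" if "norm z < 1/3" for z v
  proof -
    have "(\<Sum>i\<in>UNIV. F z $ i * cnj (L v $ i)) = (\<Sum>j\<in>UNIV. z $ j * cnj (v $ j))"
      using arg_cong[OF FL[OF that, of v], of cnj] by simp
    then show ?thesis using LL[of z v] by (simp add: G_def algebra_simps sum_subtractf)
  qed
  have GG: "(\<Sum>i\<in>UNIV. G z $ i * cnj (G w $ i)) = (FF z / 2) * cnj (FF w / 2)" if "norm z < 1/3" "norm w < 1/3" for z w
  proof -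
    have "(\<Sum>i\<in>UNIV. G z $ i * cnj (G w $ i)) = (\<Sum>i\<in>UNIV. F z $ i * cnj (F w $ i)) - (\<Sum>i\<in>UNIV. L z $ i * cnj (F w $ i)) - (\<Sum>i\<in>UNIV. G z $ i * cnj (L w $ i))"
      by (simp add: G_def algebra_simps sum_subtractf sum.distrib)
    moreover have "(\<Sum>i\<in>UNIV. L z $ i * cnj (F w $ i)) = (\<Sum>j\<in>UNIV. z $ j * cnj (w $ j))"
      using FL[OF that(2), of z] by (simp add: mult.commute)
    moreover have "(\<Sum>i\<in>UNIV. F z $ i * cnj (F w $ i)) = (\<Sum>j\<in>UNIV. z $ j * cnj (w $ j)) + FF z * cnj (FF w) / 4"
      using H_zero[OF that] by (simp add: H_def algebra_simps)
    ultimately show ?thesis using GL[OF that(1)] by simp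
  qed
  have vec0: "x = 0" if "(\<Sum>i\<in>UNIV. x $ i * cnj (x $ i)) = 0" for x :: "complex^'m"
  proof -
    have "complex_of_real (\<Sum>i\<in>UNIV. (cmod (x $ i))\<^sup>2) = 0" using that by (simp add: of_real_cmod_power2)
    then have "(\<Sum>i\<in>UNIV. (cmod (x $ i))\<^sup>2) = 0" by (simp only: of_real_eq_0_iff)
    then show ?thesis by (simp add: sum_nonneg_eq_0_iff vec_eq_iff)
  qed
  show ?thesis
  proof (cases "\<forall>z\<in>ball 0 (1/3). FF z = 0")
    case True
    then have "G z = 0" if "z \<in> ball 0 (1/3)" for z
      using GG[of z z] that by (intro vec0) simp
    then show ?thesis using that(1)[of "matrix L"] by (simp add: A G_def)
  next
    case False
    then obtain w where w: "norm w < 1/3" "FF w \<noteq> 0" by auto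
    \<comment> \<open>Scaled so that the component of \<open>G z\<close> along \<open>b\<close> is
      \<open>FF z / 2\<close>; this also makes \<open>b\<close> a unit vector.\<close>
    define b where "b = (1 / (FF w / 2)) *s G w"
    have Gb: "(\<Sum>i\<in>UNIV. G z $ i * cnj (b $ i)) = FF z / 2" if "norm z < 1/3" for z
    proof -
      have "(\<Sum>i\<in>UNIV. G z $ i * cnj (b $ i)) = (\<Sum>i\<in>UNIV. G z $ i * cnj (G w $ i)) / cnj (FF w / 2)"
        by (simp add: b_def sum_distrib_left sum_divide_distrib algebra_simps)
      then show ?thesis using GG[OF that w(1)] w(2) by simp
    qed
    have bb: "(\<Sum>i\<in>UNIV. b $ i * cnj (b $ i)) = 1"
    proof -
      have "(\<Sum>i\<in>UNIV. b $ i * cnj (b $ i)) = (1 / (FF w / 2)) * (\<Sum>i\<in>UNIV. G w $ i * cnj (b $ i))"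
        by (subst (1) b_def) (simp add: sum_distrib_left algebra_simps)
      then show ?thesis using Gb[OF w(1)] w(2) by simp
    qed
    show ?thesis
    proof (rule that(2)[of b "matrix L"])
      show "(\<Sum>i\<in>UNIV. b $ i * cnj (b $ i)) = 1" by (rule bb)
      show "(\<Sum>i\<in>UNIV. (matrix L *v v) $ i * cnj (b $ i)) = 0" for v
      proof -
        have "(\<Sum>i\<in>UNIV. L v $ i * cnj (b $ i)) = cnj ((1 / (FF w / 2)) * (\<Sum>i\<in>UNIV. G w $ i * cnj (L v $ i)))"
          by (simp add: b_def sum_distrib_left algebra_simps)
        then show ?thesis using GL[OF w(1)] by (simp add: A)
      qed
      fix z :: "complex^'n" assume "z \<in> ball 0 (1/3)"
      then have z: "norm z < 1/3" by simp
      let ?g = "FF z / 2"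
      \<comment> \<open>Each of the four terms of the expanded squared norm has modulus |g|^2, with
        signs that cancel.\<close>
      have "(\<Sum>i\<in>UNIV. (G z - ?g *s b) $ i * cnj ((G z - ?g *s b) $ i))
         = (\<Sum>i\<in>UNIV. G z $ i * cnj (G z $ i)) - cnj ?g * (\<Sum>i\<in>UNIV. G z $ i * cnj (b $ i))
           - ?g * cnj (\<Sum>i\<in>UNIV. G z $ i * cnj (b $ i)) + ?g * cnj ?g * (\<Sum>i\<in>UNIV. b $ i * cnj (b $ i))"
        by (simp add: algebra_simps sum.distrib sum_subtractf sum_distrib_left sum_divide_distrib)
      also have "\<dots> = 0" unfolding GG[OF z z] Gb[OF z] bb by (simp add: algebra_simps)
      finally have "G z - ?g *s b = 0" by (rule vec0)
      then show "F z = matrix L *v z + ?g *s b" by (simp add: A G_def algebra_simps)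
    qed
  qed
qed

lemma rational_isometry_degree:
  "rdeg P R \<le> 2 \<and> ((\<exists>A :: complex^'n^'m. \<forall>z\<in>unit_ball. F z = A *v z) \<or> rdeg P R = 2)"
proof (rule F_structure)
  fix A :: "complex^'n^'m"
  assume "\<And>z. z \<in> ball 0 (1/3) \<Longrightarrow> F z = A *v z"
  then show ?thesis using linear_case[of "1/3" A] by auto
next
  fix A :: "complex^'n^'m" and b
  assume bb: "(\<Sum>i\<in>UNIV. b $ i * cnj (b $ i)) = 1"
    and orth: "\<And>v. (\<Sum>i\<in>UNIV. (A *v v) $ i * cnj (b $ i)) = 0"
    and Feq: "\<And>z. z \<in> ball 0 (1/3) \<Longrightarrow> F z = A *v z + (FF z / 2) *s b"
  define lin where "lin i = linear_form (\<lambda>j. A $ i $ j)" for i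
  define lp where "lp = linear_form (\<lambda>j. \<Sum>i\<in>UNIV. A $ i $ j * b $ i)"
  define qp where "qp = (\<Sum>i\<in>UNIV. lin i * lin i)"
  define \<beta> where "\<beta> = (\<Sum>i\<in>UNIV. (b $ i)\<^sup>2)"
  have lin: "mpeval (lin i) z = (A *v z) $ i" for i z
    by (simp add: lin_def matrix_vector_mult_def)
  have lp: "mpeval lp z = (\<Sum>i\<in>UNIV. (A *v z) $ i * b $ i)" for z
  proof -
    have "mpeval lp z = (\<Sum>j\<in>UNIV. \<Sum>i\<in>UNIV. A $ i $ j * z $ j * b $ i)"
      by (simp add: lp_def sum_distrib_left sum_distrib_right algebra_simps)
    also have "\<dots> = (\<Sum>i\<in>UNIV. \<Sum>j\<in>UNIV. A $ i $ j * z $ j * b $ i)" by (rule sum.swap)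
    finally show ?thesis by (simp add: matrix_vector_mult_def sum_distrib_right)
  qed
  have qp: "mpeval qp z = (\<Sum>i\<in>UNIV. ((A *v z) $ i)\<^sup>2)" for z
    by (simp add: qp_def lin power2_eq_square)
  have scale: "A *v (t *s z) = t *s (A *v z)" for t z
    by (simp add: matrix_vector_mult_def vec_eq_iff sum_distrib_left algebra_simps)
  have lp_scale: "mpeval lp (t *s z) = t * mpeval lp z" for t z
    by (simp add: lp scale sum_distrib_left algebra_simps)
  have qp_scale: "mpeval qp (t *s z) = t\<^sup>2 * mpeval qp z" for t z
    by (simp add: qp scale sum_distrib_left power_mult_distrib)
  define g where "g z = FF z / 2" for z
  \<comment> \<open>The equation F\<cdot>F = 2g evaluated on F = Az + g b.\<close>
  have quad: "\<beta> * (g z)\<^sup>2 - 2 * (1 - mpeval lp z) * g z + mpeval qp z = 0" if "z \<in> ball 0 (1/3)" for z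
  proof -
    have Fz: "F z $ i = (A *v z) $ i + g z * b $ i" for i
      using arg_cong[OF Feq[OF that], of "\<lambda>x. x $ i"] by (simp add: g_def)
    have "2 * g z = (\<Sum>i\<in>UNIV. (F z $ i)\<^sup>2)" by (simp add: g_def FF_def)
    also have "\<dots> = (\<Sum>i\<in>UNIV. ((A *v z) $ i + g z * b $ i)\<^sup>2)" by (simp only: Fz)
    also have "\<dots> = mpeval qp z + 2 * g z * mpeval lp z + (g z)\<^sup>2 * \<beta>"
      by (simp add: qp lp \<beta>_def power2_eq_square algebra_simps sum.distrib sum_distrib_left)
    finally show ?thesis by (simp add: algebra_simps)
  qed
  \<comment> \<open>Pairing with \<open>b\<close> recovers g from F linearly, so g inherits the
    denominator \<open>R\<close>.\<close>
  have gF: "g z = (\<Sum>i\<in>UNIV. cnj (b $ i) * F z $ i)" if "z \<in> ball 0 (1/3)" for z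
  proof -
    have "(\<Sum>i\<in>UNIV. cnj (b $ i) * F z $ i) = (\<Sum>i\<in>UNIV. (A *v z) $ i * cnj (b $ i)) + g z * (\<Sum>i\<in>UNIV. b $ i * cnj (b $ i))"
      using Feq[OF that] by (simp add: g_def algebra_simps sum.distrib sum_distrib_left)
    then show ?thesis by (simp add: orth bb)
  qed
  consider "qp = 0" | "qp \<noteq> 0" "\<beta> \<noteq> 0" | "qp \<noteq> 0" "\<beta> = 0" by blast
  then show ?thesis
  proof cases
    case 1
    \<comment> \<open>Without q the equation factors as g times
      \<open>\<beta> * g z - 2 * (1 - mpeval lp z)\<close>. The latter is -2 at 0, hence nonzero
      nearby, and g vanishes there.\<close>
    have "continuous_on unit_ball (\<lambda>z. \<beta> * g z - 2 * (1 - mpeval lp z))"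
      unfolding g_def FF_def mpeval_def by (intro continuous_intros continuous_F) auto
    then have "isCont (\<lambda>z. \<beta> * g z - 2 * (1 - mpeval lp z)) 0"
      by (rule continuous_on_interior) (simp add: unit_ball_eq_ball)
    moreover have "\<beta> * g 0 - 2 * (1 - mpeval lp 0) \<noteq> 0"
      by (simp add: g_def FF_0 lp)
    ultimately obtain r where r: "r > 0" "\<And>z. dist 0 z < r \<Longrightarrow> \<beta> * g z - 2 * (1 - mpeval lp z) \<noteq> 0"
      using continuous_at_avoid[of 0 _ 0] by blast
    define r' where "r' = min r (1/3)"
    have "F z = A *v z" if "z \<in> ball 0 r'" for z
    proof -
      have z: "z \<in> ball 0 (1/3)" "dist 0 z < r" using that by (auto simp: r'_def)
      have "g z * (\<beta> * g z - 2 * (1 - mpeval lp z)) = 0"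
        using quad[OF z(1)] 1 by (simp add: algebra_simps power2_eq_square)
      then have "g z = 0" using r(2)[OF z(2)] by simp
      then show ?thesis using Feq[OF z(1)] by (simp add: g_def)
    qed
    then show ?thesis using linear_case[of r' A] r(1) by (auto simp: r'_def)
  next
    case 2
    have "R * qp \<noteq> 0" using 2 R_nonzero mpoly_mult_eq_0 by blast
    \<comment> \<open>Along this direction \<open>pR\<close> is not the zero polynomial, and q,
      hence the discriminant parameter \<open>d\<close>, is nonzero.\<close>
    then obtain v where v: "v \<in> ball 0 (1/3)" "mpeval (R * qp) v \<noteq> 0"
      using mpoly_nonzero_in_ball[of "R * qp" "1/3" 0] by auto
    define T where "T = (\<Sum>i\<in>UNIV. mconst (cnj (b $ i)) * P $ i)"
    obtain pR where pR: "\<And>t. mpeval R (0 + t *s v) = poly pR t" using mpeval_line by blast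
    obtain pT where pT: "\<And>t. mpeval T (0 + t *s v) = poly pT t" using mpeval_line by blast
    define l where "l = mpeval lp v"
    define d where "d = \<beta> * mpeval qp v"
    \<comment> \<open>Completing the square in the equation for g: \<open>X\<close> is
      \<open>R\<close> times the square root \<open>\<beta> * g z - (1 - mpeval lp z)\<close> of the
      discriminant, restricted to the line.\<close>
    define X where "X = smult \<beta> pT - [:1, - l:] * pR"
    let ?D = "[:1, - 2 * l, l\<^sup>2 - d:]"
    have pR0: "pR \<noteq> 0" using pR[of 1] v by auto
    have z: "poly (pR * (X\<^sup>2 - ?D * pR\<^sup>2)) t = 0" if t: "t \<in> ball 0 1" for t
    proof (cases "poly pR t = 0")
      case False
      let ?z = "t *s v"
      have "cmod t * norm v \<le> 1 * norm v" using t by (intro mult_right_mono) auto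
      then have zb: "?z \<in> ball 0 (1/3)" using v by (simp add: norm_vector_scalar_mult)
      then have zU: "?z \<in> U" using False pR[of t] by (simp add: U_def unit_ball_eq_ball)
      have gz: "g ?z * poly pR t = poly pT t"
        using gF[OF zb] F_rational[OF zU] False pT[of t] pR[of t]
        by (simp add: T_def sum_divide_distrib[symmetric])
      have "poly X t = (\<beta> * g ?z - (1 - l * t)) * poly pR t"
        by (simp add: X_def gz[symmetric] algebra_simps)
      moreover have "(\<beta> * g ?z - (1 - l * t))\<^sup>2 = poly ?D t"
      proof -
        have "(\<beta> * g ?z - (1 - l * t))\<^sup>2 = \<beta> * (\<beta> * (g ?z)\<^sup>2 - 2 * (1 - mpeval lp ?z) * g ?z + mpeval qp ?z) + (1 - l * t)\<^sup>2 - \<beta> * mpeval qp ?z"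
          by (simp add: lp_scale l_def power2_eq_square algebra_simps)
        also have "\<dots> = (1 - l * t)\<^sup>2 - t\<^sup>2 * d" using quad[OF zb] by (simp add: qp_scale d_def)
        finally show ?thesis by (simp add: power2_eq_square algebra_simps)
      qed
      ultimately have "(poly X t)\<^sup>2 = poly ?D t * (poly pR t)\<^sup>2" by (simp only: power_mult_distrib)
      then show ?thesis by (simp only: poly_mult poly_diff poly_power) simp
    qed simp
    have "pR * (X\<^sup>2 - ?D * pR\<^sup>2) = 0"
    proof (rule ccontr)
      assume "pR * (X\<^sup>2 - ?D * pR\<^sup>2) \<noteq> 0"
      from poly_roots_finite[OF this] have "finite (ball (0::complex) 1)"
        by (rule rev_finite_subset) (use z in blast)
      then show False using uncountable_infinite[OF uncountable_ball[of 1 "0::complex"]] by simp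
    qed
    then have "X\<^sup>2 = ?D * pR\<^sup>2" using pR0 by simp
    moreover have "d \<noteq> 0" using 2 v by (simp add: d_def)
    ultimately have False using not_square_of_rational pR0 by blast
    then show ?thesis ..
  next
    case 3
    \<comment> \<open>The numerators of Az + q b / (2(1-l)) over the denominator 1 - l.\<close>
    define Q where "Q i = (1 - lp) * lin i + mconst (b $ i / 2) * qp" for i
    have PQ: "(1 - lp) * P $ i = R * Q i" for i
    proof -
      have "R * ((1 - lp) * P $ i - R * Q i) = 0"
      proof (rule mpoly_eqI_ball[of "1/3" 0])
        fix z :: "complex^'n" assume z: "z \<in> ball 0 (1/3)"
        show "mpeval (R * ((1 - lp) * P $ i - R * Q i)) z = mpeval 0 z"
        proof (cases "mpeval R z = 0")
          case False
          then have "z \<in> U" using z by (simp add: U_def unit_ball_eq_ball)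
          from F_rational[OF this, of i] False have Pz: "mpeval (P $ i) z = mpeval R z * F z $ i" by simp
          have Fz: "F z $ i = (A *v z) $ i + g z * b $ i" using Feq[OF z] by (simp add: g_def)
          have qz: "mpeval qp z = 2 * (1 - mpeval lp z) * g z" using quad[OF z] 3 by simp
          show ?thesis unfolding Q_def by (simp add: Pz Fz qz lin algebra_simps)
        qed simp
      qed auto
      then show ?thesis using mpoly_mult_eq_0 R_nonzero by fastforce
    qed
    have lp1: "1 - lp \<noteq> 0"
    proof
      assume "1 - lp = 0"
      then have "mpeval (1 - lp) 0 = 0" by simp
      then show False by (simp add: lp)
    qed
    obtain i0 where i0: "b $ i0 \<noteq> 0" using bb by force
    \<comment> \<open>A component with nonzero \<open>b\<close> exhibits \<open>R * qp\<close> as a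
      multiple of 1 - l; since q is homogeneous, the divisor passes to \<open>R\<close>.\<close>
    have "R * qp = mconst (2 / b $ i0) * ((1 - lp) * P $ i0 - R * ((1 - lp) * lin i0))"
      unfolding PQ by (rule mpoly_eqI) (use i0 in \<open>simp add: Q_def algebra_simps\<close>)
    also have "\<dots> = (1 - lp) * (mconst (2 / b $ i0) * (P $ i0 - R * lin i0))"
      by (simp add: algebra_simps)
    finally have "(1 - lp) dvd R * qp" by simp
    then have "(1 - lp) dvd R"
      unfolding lp_def by (intro dvd_of_dvd_mult_homogeneous[where q=qp and d=2 and f=R]) (use qp_scale 3 in auto)
    then obtain S where S: "R = (1 - lp) * S" by (metis dvdE)
    have PS: "P $ i = S * Q i" for i
    proof -
      have "(1 - lp) * (P $ i - S * Q i) = 0" using PQ[of i] S by (simp add: algebra_simps)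
      then show ?thesis using mpoly_mult_eq_0 lp1 by fastforce
    qed
    \<comment> \<open>The common factor \<open>S\<close> must be a scalar, so up to that scalar the
      given representation is \<open>Q\<close> over 1 - l.\<close>
    have "S dvd R" "\<And>i. S dvd P $ i" using S PS by auto
    then have "S dvd 1"
      using rational unfolding rational_rep_def lowest_terms_rep_def by blast
    then obtain s where s: "s \<noteq> 0" "S = mconst s" using mpoly_unit_const by blast
    have d1: "mdeg (1 - lp) \<le> 1"
      unfolding lp_def by (intro mdeg_diff mdeg_linear_form) simp
    have dlin: "mdeg (lin i) \<le> 1" for i unfolding lin_def by (rule mdeg_linear_form)
    have dqp: "mdeg qp \<le> 1 + 1" unfolding qp_def by (intro mdeg_sum mdeg_mult dlin)
    have "mdeg (Q i) \<le> 2" for i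
      unfolding Q_def using mdeg_mult[OF d1 dlin[of i]] mdeg_mult[of "mconst (b $ i / 2)" 0 qp 2] dqp
      by (intro mdeg_add) (auto simp: numeral_2_eq_2)
    then have dP: "mdeg (P $ i) \<le> 2" for i
      using mdeg_mult[of S 0 "Q i" 2] by (simp add: PS s)
    have dR: "mdeg R \<le> 2" using mdeg_mult[of "1 - lp" 1 S 0] d1 by (simp add: S s)
    have le2: "rdeg P R \<le> 2" using dP dR by (simp add: rdeg_le_iff)
    moreover have "\<not> rdeg P R \<le> 1"
    proof
      assume "rdeg P R \<le> 1"
      then have dP1: "mdeg (P $ i) \<le> 1" for i by (simp add: rdeg_le_iff)
      obtain z where z: "mpeval qp z \<noteq> 0" using 3 mpoly_nonzero_somewhere by blast
      \<comment> \<open>If the degree were at most 1, the t^2 coefficient of each numerator along t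
        z would vanish.\<close>
      have coef: "b $ i * mpeval qp z / 2 = mpeval lp z * (A *v z) $ i" for i
      proof -
        obtain p where p: "degree p \<le> mdeg (P $ i)" "\<And>t. mpeval (P $ i) (t *s z) = poly p t"
          using mpeval_ray_degree by blast
        let ?p = "smult s [:0, (A *v z) $ i, b $ i * mpeval qp z / 2 - mpeval lp z * (A *v z) $ i:]"
        have "poly p t = poly ?p t" for t
          by (simp add: p(2)[symmetric] PS s Q_def lin lp_scale qp_scale scale algebra_simps power2_eq_square)
        then have "p = ?p" by (meson poly_eq_poly_eq_iff ext)
        moreover have "coeff p 2 = 0" using p(1) dP1[of i] by (intro coeff_eq_0) simp
        ultimately show ?thesis using s by (simp add: numeral_2_eq_2)
      qed
      \<comment> \<open>Pairing with the unit vector \<open>b\<close> leaves q on one side and kills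
        Az on the other, against the choice of z.\<close>
      have "mpeval qp z / 2 = (\<Sum>i\<in>UNIV. (b $ i * mpeval qp z / 2) * cnj (b $ i))"
        using arg_cong[OF bb, of "\<lambda>x. mpeval qp z / 2 * x"] by (simp add: sum_distrib_left algebra_simps)
      also have "\<dots> = mpeval lp z * (\<Sum>i\<in>UNIV. (A *v z) $ i * cnj (b $ i))"
        unfolding coef by (simp add: sum_distrib_left algebra_simps)
      also have "\<dots> = 0" by (simp add: orth)
      finally show False using z by simp
    qed
    ultimately show ?thesis by linarith
  qed
qed

end

end

theorem mainTheorem8:
  fixes F :: "complex^'n::finite \<Rightarrow> complex^'m::finite"
    and P :: "('n mpoly)^'m" and R :: "'n mpoly"
    and c c' lam :: real
  assumes "CARD('m) \<ge> CARD('n) + 1" and "CARD('n) + 1 \<ge> 3"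
    and "c > 0" and "c' > 0" and "lam > 0"
    and "holo_isometry c c' F lam"
    and "rational_rep F P R"
    and "F 0 = 0"
  shows "rdeg P R \<le> 2 \<and>
         ((\<exists>A :: complex^'n^'m. \<forall>z\<in>unit_ball. F z = A *v z) \<or> rdeg P R = 2)"
proof -
  interpret rational_isometry F P R c c' lam
    using assms by unfold_locales
  show ?thesis using assms(2) by (intro rational_isometry_degree) simp
qed

end
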